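(* Let $J\neq F_n^\infty$ be a WOT-closed two-sided ideal of $F_n^\infty$ generated by a family of polynomials $\mathcal P_J\subset F_n^\infty$ and let $T:=[T_1,\ldots,T_n]$, $T_i\in B(\mathcal H)$, be a row contraction such that $$p(T_1,\ldots,T_n)=0\quad\text{for any }p\in\mathcal P_J.$$ Then there exist a Hilbert space $\mathcal K$ and operators $Z_i\in B(\mathcal K)$, $i=1,\dots,n$, with the properties $$Z_1Z_1^*+\cdots+Z_nZ_n^*=I_{\mathcal K}\quad\text{and}\quad p(Z_1,\ldots,Z_n)=0\ \text{ for any }p\in\mathcal P_J,$$ such that: (i) $\mathcal H$ can be identified (via an isometry) with a co-invariant subspace of $\tilde{\mathcal K}:=(\mathcal N_J\otimes\overline{\Delta_T\mathcal H})\oplus\mathcal K$ under the operators $$V_i:=\begin{bmatrix}B_i\otimes I_{\overline{\Delta_T\mathcal H}}&0\\0&Z_i\end{bmatrix},\quad i=1,\ldots,n;$$ (ii) under this identification, $T_i^*=V_i^*|_{\mathcal H}$, $i=1,\ldots,n$. Moreover, $\mathcal K=\{0\}$ if and only if $[T_1,\ldots,T_n]$ is a pure row contraction.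
   Context: Let $n\in\{1,2,\dots\}$ and let $F^2(H_n)=\bigoplus_{k\ge 0}H_n^{\otimes k}$ be the full Fock space of an $n$-dimensional complex Hilbert space $H_n$ with orthonormal basis $e_1,\dots,e_n$ (with $H_n^{\otimes 0}=\mathbb C1$). The left creation operators are $S_i\varphi=e_i\otimes\varphi$. $F_n^\infty\subset B(F^2(H_n))$ is the WOT-closed algebra generated by $S_1,\dots,S_n$ and the identity. Polynomials in $F_n^\infty$ are the operators $p(S_1,\dots,S_n)$, $p$ a polynomial in $n$ noncommuting indeterminates; $p(T_1,\dots,T_n)$ is the corresponding evaluation. "Generated by $\mathcal P_J$" means $J$ is the smallest WOT-closed two-sided ideal containing $\mathcal P_J$. Put $\mathcal N_J=F^2(H_n)\ominus\overline{JF^2(H_n)}$ and $B_i=P_{\mathcal N_J}S_i|_{\mathcal N_J}$. $T=[T_1,\dots,T_n]$ is a row contraction if $\sum_iT_iT_i^*\le I$; $\Delta_T=(I-\sum_iT_iT_i^* )^{1/2}$. For a word $\alpha=g_{i_1}\cdots g_{i_k}$ in the free semigroup $\mathbb F_n^+$, $T_\alpha=T_{i_1}\cdots T_{i_k}$ and $|\alpha|=k$. $T$ is pure if $\text{SOT-}\lim_{k\to\infty}\sum_{|\alpha|=k}T_\alpha T_\alpha^*=0$. A subspace is co-invariant under a set of operators if it is invariant under their adjoints. *)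

theory Defs
  imports "HOL-Analysis.Analysis" "HOL-Library.Poly_Mapping"
begin

section \<open>Complex Hilbert spaces\<close>

(* The inner product is linear in the first and conjugate-linear in the second argument. *)
class complex_inner = real_normed_vector +
  fixes scaleC :: "complex \<Rightarrow> 'a \<Rightarrow> 'a"
    and cinner :: "'a \<Rightarrow> 'a \<Rightarrow> complex"
  assumes scaleC_add_right: "scaleC c (x + y) = scaleC c x + scaleC c y"
    and scaleC_add_left: "scaleC (c + d) x = scaleC c x + scaleC d x"
    and scaleC_scaleC: "scaleC c (scaleC d x) = scaleC (c * d) x"
    and scaleR_scaleC: "scaleR r x = scaleC (complex_of_real r) x"
    and cinner_commute: "cinner x y = cnj (cinner y x)"
    and cinner_add_left: "cinner (x + y) z = cinner x z + cinner y z"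
    and cinner_scaleC_left: "cinner (scaleC c x) y = c * cinner x y"
    and norm_eq_sqrt_cinner: "norm x = sqrt (Re (cinner x x))"

class chilbert_space = complex_inner + complete_space

subclass (in chilbert_space) banach ..

lemma scaleC_one: "scaleC 1 x = (x :: 'a :: complex_inner)"
  using scaleR_scaleC[of 1 x] by simp

global_interpretation complex_vector: vector_space "scaleC :: complex \<Rightarrow> 'a \<Rightarrow> 'a :: complex_inner"
  defines cspan = complex_vector.span
    and csubspace = complex_vector.subspace
  by unfold_locales (simp_all add: scaleC_add_right scaleC_add_left scaleC_scaleC scaleC_one)

lemma cinner_self_eq_norm: "cinner x x = complex_of_real ((norm x)\<^sup>2)"
proof -
  have "Im (cinner x x) = 0"
    using cinner_commute[of x x] by (simp add: complex_eq_iff)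
  moreover have "0 \<le> Re (cinner x x)"
    using norm_ge_zero[of x] unfolding norm_eq_sqrt_cinner by simp
  ultimately show ?thesis
    by (simp add: complex_eq_iff norm_eq_sqrt_cinner)
qed

lemma norm_scaleC: "norm (scaleC c x) = cmod c * norm (x :: 'a :: complex_inner)"
proof -
  have "cinner (scaleC c x) (scaleC c x) = c * cnj c * cinner x x"
    by (subst cinner_scaleC_left, subst cinner_commute, subst cinner_scaleC_left)
       (simp add: cinner_commute[of x x, symmetric])
  also have "\<dots> = complex_of_real ((cmod c * norm x)\<^sup>2)"
    by (simp add: cinner_self_eq_norm complex_norm_square[symmetric] power_mult_distrib)
  finally show ?thesis
    by (simp add: norm_eq_sqrt_cinner[of "scaleC c x"])
qed

lemma cinner_expand: "(norm (x + y))\<^sup>2 = (norm x)\<^sup>2 + (norm y)\<^sup>2 + 2 * Re (cinner x y)"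
  for x y :: "'a :: complex_inner"
proof -
  have right: "cinner z (x + y) = cinner z x + cinner z y" for z :: 'a
    by (subst cinner_commute, subst cinner_add_left)
       (simp add: cinner_commute[of z x] cinner_commute[of z y])
  have "complex_of_real ((norm (x + y))\<^sup>2) = cinner x x + cinner y y + (cinner x y + cnj (cinner x y))"
    unfolding cinner_self_eq_norm[symmetric]
    by (simp add: cinner_add_left right cinner_commute[of y x])
  then have "Re (complex_of_real ((norm (x + y))\<^sup>2)) = 
      Re (cinner x x + cinner y y + (cinner x y + cnj (cinner x y)))" by simp
  then show ?thesis by (simp add: cinner_self_eq_norm)
qed

lemma two_cmod_cinner_le: "2 * cmod (cinner x y) \<le> (norm x)\<^sup>2 + (norm y)\<^sup>2"
  for x y :: "'a :: complex_inner"
proof -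
  define c where "c = (if cinner x y = 0 then 1 else - cnj (sgn (cinner x y)))"
  have c: "cmod c = 1"
    by (simp add: c_def norm_sgn)
  have "c * cinner x y = - complex_of_real (cmod (cinner x y))"
  proof (cases "cinner x y = 0")
    case False
    have "cnj (sgn z) * z = complex_of_real (cmod z)" if "z \<noteq> 0" for z :: complex
      using that complex_norm_square[of z] by (simp add: sgn_eq field_simps power2_eq_square)
    then show ?thesis using False by (simp add: c_def)
  qed (simp add: c_def)
  then have "Re (cinner (scaleC c x) y) = - cmod (cinner x y)"
    by (simp add: cinner_scaleC_left)
  then have "(norm (scaleC c x + y))\<^sup>2 = (norm x)\<^sup>2 + (norm y)\<^sup>2 - 2 * cmod (cinner x y)"
    by (simp add: cinner_expand norm_scaleC c)
  then show ?thesis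
    by (smt (verit) zero_le_power2)
qed

instantiation complex :: chilbert_space
begin
definition scaleC_complex :: "complex \<Rightarrow> complex \<Rightarrow> complex" where "scaleC_complex c x = c * x"
definition cinner_complex :: "complex \<Rightarrow> complex \<Rightarrow> complex" where "cinner_complex x y = x * cnj y"
instance
  by standard
     (auto simp: scaleC_complex_def cinner_complex_def algebra_simps scaleR_conv_of_real cmod_def
        power2_eq_square)
end

instantiation prod :: (complex_inner, complex_inner) complex_inner
begin
definition scaleC_prod :: "complex \<Rightarrow> 'a \<times> 'b \<Rightarrow> 'a \<times> 'b"
  where "scaleC_prod c x = (scaleC c (fst x), scaleC c (snd x))"
definition cinner_prod :: "'a \<times> 'b \<Rightarrow> 'a \<times> 'b \<Rightarrow> complex"
  where "cinner_prod x y = cinner (fst x) (fst y) + cinner (snd x) (snd y)"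
instance
proof
  fix x y :: "'a \<times> 'b"
  show "cinner x y = cnj (cinner y x)"
    by (simp add: cinner_prod_def cinner_commute[of "fst x"] cinner_commute[of "snd x"])
  show "norm x = sqrt (Re (cinner x x))"
    by (simp add: cinner_prod_def norm_prod_def cinner_self_eq_norm)
qed (auto simp: scaleC_prod_def cinner_prod_def scaleC_add_right scaleC_add_left scaleC_scaleC
      scaleR_scaleC scaleR_prod_def cinner_add_left cinner_scaleC_left algebra_simps)
end

instance prod :: (chilbert_space, chilbert_space) chilbert_space ..


section \<open>Square-summable families\<close>

typedef (overloaded) ('i, 'a :: complex_inner) ell2 =
  "{f :: 'i \<Rightarrow> 'a. (\<lambda>i. (norm (f i))\<^sup>2) summable_on UNIV}"
  morphisms ell2_nth Abs_ell2
  by (rule exI[of _ "\<lambda>_. 0"]) simp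

setup_lifting type_definition_ell2

lemma square_summable_comparison:
  fixes f g h :: "'i \<Rightarrow> real"
  assumes "f summable_on UNIV" "g summable_on UNIV"
    and "\<And>i. 0 \<le> h i" "\<And>i. h i \<le> C * (f i + g i)"
  shows "h summable_on UNIV"
proof (rule summable_on_comparison_test)
  show "(\<lambda>i. C * (f i + g i)) summable_on UNIV"
    by (intro summable_on_cmult_right summable_on_add assms)
qed (use assms in auto)

lemma norm_add_square_le: "(norm (x + y))\<^sup>2 \<le> 2 * ((norm x)\<^sup>2 + (norm y)\<^sup>2)"
  for x y :: "'a :: real_normed_vector"
proof -
  have "(norm (x + y))\<^sup>2 \<le> (norm x + norm y)\<^sup>2"
    by (intro power_mono norm_triangle_ineq) auto
  also have "\<dots> \<le> 2 * ((norm x)\<^sup>2 + (norm y)\<^sup>2)"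
    using zero_le_power2[of "norm x - norm y"] by (simp add: power2_eq_square algebra_simps)
  finally show ?thesis .
qed

instantiation ell2 :: (type, complex_inner) complex_inner
begin

lift_definition zero_ell2 :: "('a, 'b) ell2" is "\<lambda>_. 0" by simp

lift_definition plus_ell2 :: "('a, 'b) ell2 \<Rightarrow> ('a, 'b) ell2 \<Rightarrow> ('a, 'b) ell2"
  is "\<lambda>f g i. f i + g i"
  by (rule square_summable_comparison[where C = 2], assumption, assumption)
     (use norm_add_square_le in auto)

lift_definition uminus_ell2 :: "('a, 'b) ell2 \<Rightarrow> ('a, 'b) ell2" is "\<lambda>f i. - f i" by simp

definition minus_ell2 :: "('a, 'b) ell2 \<Rightarrow> ('a, 'b) ell2 \<Rightarrow> ('a, 'b) ell2"
  where "f - g = f + - (g :: ('a, 'b) ell2)"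

lift_definition scaleC_ell2 :: "complex \<Rightarrow> ('a, 'b) ell2 \<Rightarrow> ('a, 'b) ell2"
  is "\<lambda>c f i. scaleC c (f i)"
  by (simp add: norm_scaleC power_mult_distrib summable_on_cmult_right)

definition scaleR_ell2 :: "real \<Rightarrow> ('a, 'b) ell2 \<Rightarrow> ('a, 'b) ell2"
  where "scaleR_ell2 r = scaleC (complex_of_real r)"

definition cinner_ell2 :: "('a, 'b) ell2 \<Rightarrow> ('a, 'b) ell2 \<Rightarrow> complex"
  where "cinner_ell2 f g = (\<Sum>\<^sub>\<infinity>i. cinner (ell2_nth f i) (ell2_nth g i))"

definition norm_ell2 :: "('a, 'b) ell2 \<Rightarrow> real"
  where "norm_ell2 f = sqrt (\<Sum>\<^sub>\<infinity>i. (norm (ell2_nth f i))\<^sup>2)"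

definition dist_ell2 :: "('a, 'b) ell2 \<Rightarrow> ('a, 'b) ell2 \<Rightarrow> real"
  where "dist_ell2 f g = norm (f - g)"

definition sgn_ell2 :: "('a, 'b) ell2 \<Rightarrow> ('a, 'b) ell2"
  where "sgn_ell2 f = scaleR (inverse (norm f)) f"

definition uniformity_ell2 :: "(('a, 'b) ell2 \<times> ('a, 'b) ell2) filter"
  where "uniformity_ell2 = (INF e\<in>{0<..}. principal {(x, y). dist x y < e})"

definition open_ell2 :: "('a, 'b) ell2 set \<Rightarrow> bool"
  where "open_ell2 U = (\<forall>x\<in>U. \<forall>\<^sub>F (x', y) in uniformity. x' = x \<longrightarrow> y \<in> U)"

lemma summable_ell2: "(\<lambda>i. (norm (ell2_nth f i))\<^sup>2) summable_on UNIV"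
  using ell2_nth[of f] by simp

lemma finite_sum_le_norm_ell2:
  assumes "finite F"
  shows "(\<Sum>i\<in>F. (norm (ell2_nth f i))\<^sup>2) \<le> (norm f)\<^sup>2"
  unfolding norm_ell2_def using assms
  by (simp add: infsum_nonneg finite_sum_le_infsum summable_ell2)

lemma norm_ell2_leI:
  assumes "\<And>F. finite F \<Longrightarrow> (\<Sum>i\<in>F. (norm (ell2_nth f i))\<^sup>2) \<le> C\<^sup>2" "0 \<le> C"
  shows "norm f \<le> C"
  unfolding norm_ell2_def
  by (intro real_le_lsqrt infsum_le_finite_sums summable_ell2 assms)

lemma L2_set_le_norm_ell2: "finite F \<Longrightarrow> L2_set (\<lambda>i. norm (ell2_nth f i)) F \<le> norm f"
  unfolding L2_set_def
  by (intro real_le_lsqrt finite_sum_le_norm_ell2) (auto simp: norm_ell2_def infsum_nonneg)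

lemma summable_cinner_ell2: "(\<lambda>i. cinner (ell2_nth f i) (ell2_nth g i)) summable_on UNIV"
proof (rule abs_summable_summable, rule square_summable_comparison)
  fix i
  show "cmod (cinner (ell2_nth f i) (ell2_nth g i))
      \<le> 1 * ((norm (ell2_nth f i))\<^sup>2 + (norm (ell2_nth g i))\<^sup>2)"
    using two_cmod_cinner_le[of "ell2_nth f i" "ell2_nth g i"] norm_ge_zero
    by (smt (verit))
qed (use summable_ell2 in auto)

instance
proof
  fix a b :: real and c d :: complex and x y z :: "('a, 'b) ell2"
  show "x + y + z = x + (y + z)" by transfer (simp add: add.assoc)
  show "x + y = y + x" by transfer (simp add: add.commute)
  show "0 + x = x" by transfer simp
  show "- x + x = 0" by transfer simp
  show "x - y = x + - y" by (simp add: minus_ell2_def)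
  show cadd: "scaleC c (x + y) = scaleC c x + scaleC c y" for c :: complex and x y :: "('a, 'b) ell2"
    by transfer (simp add: scaleC_add_right)
  show cadd2: "scaleC (c + d) x = scaleC c x + scaleC d x" for c d :: complex and x :: "('a, 'b) ell2"
    by transfer (simp add: scaleC_add_left)
  show cmul: "scaleC c (scaleC d x) = scaleC (c * d) x" for c d :: complex and x :: "('a, 'b) ell2"
    by transfer (simp add: scaleC_scaleC)
  show "a *\<^sub>R x = scaleC (complex_of_real a) x" by (simp add: scaleR_ell2_def)
  show "a *\<^sub>R (x + y) = a *\<^sub>R x + a *\<^sub>R y" by (simp add: scaleR_ell2_def cadd)
  show "(a + b) *\<^sub>R x = a *\<^sub>R x + b *\<^sub>R x" by (simp add: scaleR_ell2_def cadd2)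
  show "a *\<^sub>R b *\<^sub>R x = (a * b) *\<^sub>R x" by (simp add: scaleR_ell2_def cmul)
  show "1 *\<^sub>R x = x" unfolding scaleR_ell2_def by transfer (simp add: scaleC_one)
  show "dist x y = norm (x - y)" by (simp add: dist_ell2_def)
  show "sgn x = inverse (norm x) *\<^sub>R x" by (simp add: sgn_ell2_def)
  show "uniformity = (INF e\<in>{0<..}. principal {(x :: ('a, 'b) ell2, y). dist x y < e})"
    by (simp add: uniformity_ell2_def)
  show "open U \<longleftrightarrow> (\<forall>x\<in>U. \<forall>\<^sub>F (x', y) in uniformity. x' = x \<longrightarrow> y \<in> U)" for U :: "('a, 'b) ell2 set"
    by (simp add: open_ell2_def)
  show "norm x = 0 \<longleftrightarrow> x = 0"
  proof
    assume 0: "norm x = 0"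
    have "ell2_nth x i = 0" for i
      using finite_sum_le_norm_ell2[of "{i}" x] 0 by simp
    then have "ell2_nth x = ell2_nth 0" by (auto simp: zero_ell2.rep_eq)
    then show "x = 0" by (simp only: ell2_nth_inject)
  next
    assume "x = 0"
    then show "norm x = 0" by (simp add: norm_ell2_def zero_ell2.rep_eq)
  qed
  show "norm (x + y) \<le> norm x + norm y"
  proof (rule norm_ell2_leI)
    fix F :: "'a set" assume F: "finite F"
    have "L2_set (\<lambda>i. norm (ell2_nth (x + y) i)) F
        \<le> L2_set (\<lambda>i. norm (ell2_nth x i) + norm (ell2_nth y i)) F"
      by (rule L2_set_mono) (auto simp: plus_ell2.rep_eq norm_triangle_ineq)
    also have "\<dots> \<le> L2_set (\<lambda>i. norm (ell2_nth x i)) F + L2_set (\<lambda>i. norm (ell2_nth y i)) F"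
      by (rule L2_set_triangle_ineq)
    also have "\<dots> \<le> norm x + norm y"
      by (intro add_mono L2_set_le_norm_ell2 F)
    finally have "(L2_set (\<lambda>i. norm (ell2_nth (x + y) i)) F)\<^sup>2 \<le> (norm x + norm y)\<^sup>2"
      by (rule power_mono) (rule L2_set_nonneg)
    then show "(\<Sum>i\<in>F. (norm (ell2_nth (x + y) i))\<^sup>2) \<le> (norm x + norm y)\<^sup>2"
      unfolding L2_set_def by (subst (asm) real_sqrt_pow2) (auto intro: sum_nonneg)
  qed (auto simp: norm_ell2_def infsum_nonneg)
  show "norm (a *\<^sub>R x) = \<bar>a\<bar> * norm x"
    by (simp add: norm_ell2_def scaleR_ell2_def scaleC_ell2.rep_eq norm_scaleC power_mult_distrib
        infsum_cmult_right' real_sqrt_mult)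
  have "cinner y x = (\<Sum>\<^sub>\<infinity>i. cnj (cinner (ell2_nth x i) (ell2_nth y i)))"
    unfolding cinner_ell2_def by (rule infsum_cong) (rule cinner_commute)
  also have "\<dots> = cnj (cinner x y)"
    unfolding cinner_ell2_def by (rule infsum_cnj)
  finally show "cinner x y = cnj (cinner y x)"
    by simp
  show "cinner (x + y) z = cinner x z + cinner y z"
    by (simp add: cinner_ell2_def plus_ell2.rep_eq cinner_add_left infsum_add summable_cinner_ell2)
  show "cinner (scaleC c x) y = c * cinner x y"
    by (simp add: cinner_ell2_def scaleC_ell2.rep_eq cinner_scaleC_left infsum_cmult_right')
  have "cinner x x = (\<Sum>\<^sub>\<infinity>i. complex_of_real ((norm (ell2_nth x i))\<^sup>2))"
    by (simp add: cinner_ell2_def cinner_self_eq_norm)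
  also have "\<dots> = complex_of_real (\<Sum>\<^sub>\<infinity>i. (norm (ell2_nth x i))\<^sup>2)"
    by (intro infsumI has_sum_of_real has_sum_infsum summable_ell2)
  finally show "norm x = sqrt (Re (cinner x x))"
    by (simp add: norm_ell2_def)
qed

end

lemma norm_nth_le_ell2: "norm (ell2_nth f i) \<le> norm f"
  using finite_sum_le_norm_ell2[of "{i}" f] by (auto intro: power2_le_imp_le simp: norm_ell2_def infsum_nonneg)

lemma minus_ell2_nth: "ell2_nth (f - g) i = ell2_nth f i - ell2_nth g i"
  unfolding minus_ell2_def plus_ell2.rep_eq uminus_ell2.rep_eq by simp

instance ell2 :: (type, chilbert_space) chilbert_space
proof
  fix X :: "nat \<Rightarrow> ('a, 'b) ell2"
  assume X: "Cauchy X"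
  have "Cauchy (\<lambda>n. ell2_nth (X n) i)" for i
  proof (rule metric_CauchyI)
    fix e :: real assume "0 < e"
    then obtain M where "\<forall>m\<ge>M. \<forall>n\<ge>M. dist (X m) (X n) < e"
      using X metric_CauchyD by blast
    then show "\<exists>M. \<forall>m\<ge>M. \<forall>n\<ge>M. dist (ell2_nth (X m) i) (ell2_nth (X n) i) < e"
      by (metis dist_norm le_less_trans minus_ell2_nth norm_nth_le_ell2)
  qed
  then have "\<forall>i. \<exists>l. (\<lambda>n. ell2_nth (X n) i) \<longlonglongrightarrow> l"
    by (simp add: Cauchy_convergent_iff convergent_def)
  then obtain g where g: "\<And>i. (\<lambda>n. ell2_nth (X n) i) \<longlonglongrightarrow> g i"
    by metis
  have bound: "\<exists>M. \<forall>m\<ge>M. \<forall>F. finite F \<longrightarrow> (\<Sum>i\<in>F. (norm (ell2_nth (X m) i - g i))\<^sup>2) \<le> e\<^sup>2"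
    if e: "0 < e" for e :: real
  proof -
    obtain M where M: "\<forall>m\<ge>M. \<forall>n\<ge>M. dist (X m) (X n) < e"
      using X e metric_CauchyD by blast
    show ?thesis
    proof (intro exI allI impI)
      fix m F assume m: "M \<le> m" and F: "finite (F :: 'a set)"
      show "(\<Sum>i\<in>F. (norm (ell2_nth (X m) i - g i))\<^sup>2) \<le> e\<^sup>2"
      proof (rule Lim_bounded)
        show "(\<lambda>n. \<Sum>i\<in>F. (norm (ell2_nth (X m) i - ell2_nth (X n) i))\<^sup>2)
            \<longlonglongrightarrow> (\<Sum>i\<in>F. (norm (ell2_nth (X m) i - g i))\<^sup>2)"
          by (intro tendsto_intros g)
        show "\<forall>n\<ge>M. (\<Sum>i\<in>F. (norm (ell2_nth (X m) i - ell2_nth (X n) i))\<^sup>2) \<le> e\<^sup>2"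
        proof (intro allI impI)
          fix n assume n: "M \<le> n"
          have "(\<Sum>i\<in>F. (norm (ell2_nth (X m) i - ell2_nth (X n) i))\<^sup>2) \<le> (norm (X m - X n))\<^sup>2"
            using finite_sum_le_norm_ell2[OF F, of "X m - X n"] by (simp add: minus_ell2_nth)
          also have "\<dots> \<le> e\<^sup>2"
            using M m n by (intro power_mono) (auto simp: dist_norm less_imp_le)
          finally show "(\<Sum>i\<in>F. (norm (ell2_nth (X m) i - ell2_nth (X n) i))\<^sup>2) \<le> e\<^sup>2" .
        qed
      qed
    qed
  qed
  obtain M where M: "\<forall>m\<ge>M. \<forall>F. finite F \<longrightarrow> (\<Sum>i\<in>F. (norm (ell2_nth (X m) i - g i))\<^sup>2) \<le> 1\<^sup>2"
    using bound[of 1] by auto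
  have "(\<lambda>i. (norm (ell2_nth (X M) i - g i))\<^sup>2) summable_on UNIV"
    by (rule nonneg_bdd_above_summable_on) (use M in \<open>auto intro!: bdd_aboveI2[where M = "1\<^sup>2"]\<close>)
  then have "(\<lambda>i. (norm (g i))\<^sup>2) summable_on UNIV"
  proof (rule square_summable_comparison[OF summable_ell2[of "X M"]])
    show "(norm (g i))\<^sup>2 \<le> 2 * ((norm (ell2_nth (X M) i))\<^sup>2 + (norm (ell2_nth (X M) i - g i))\<^sup>2)" for i
      using norm_add_square_le[of "ell2_nth (X M) i" "g i - ell2_nth (X M) i"]
      by (simp add: norm_minus_commute)
  qed simp
  then have G: "ell2_nth (Abs_ell2 g) = g"
    by (simp add: Abs_ell2_inverse)
  have "X \<longlonglongrightarrow> Abs_ell2 g"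
  proof (rule metric_LIMSEQ_I)
    fix r :: real assume r: "0 < r"
    obtain M where M: "\<forall>m\<ge>M. \<forall>F. finite F \<longrightarrow> (\<Sum>i\<in>F. (norm (ell2_nth (X m) i - g i))\<^sup>2) \<le> (r/2)\<^sup>2"
      using bound[of "r/2"] r by auto
    have "norm (X m - Abs_ell2 g) \<le> r/2" if "m \<ge> M" for m
      by (rule norm_ell2_leI) (use M that r in \<open>auto simp: minus_ell2_nth G\<close>)
    then show "\<exists>M. \<forall>m\<ge>M. dist (X m) (Abs_ell2 g) < r"
      using r by (intro exI[of _ M]) (force simp: dist_norm)
  qed
  then show "convergent X" by (auto simp: convergent_def)
qed


section \<open>Operators\<close>

(* Bounded linear operators from a subspace M to a subspace N are represented by functions of
   which only the values on M matter.  In particular "bounded_ops UNIV UNIV" is B(H), and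
   "bounded_ops M M" is B(M). *)
definition bounded_ops :: "'a :: complex_inner set \<Rightarrow> 'b :: complex_inner set \<Rightarrow> ('a \<Rightarrow> 'b) set" where
  "bounded_ops M N = {A. (\<forall>x\<in>M. A x \<in> N) \<and>
     (\<forall>x\<in>M. \<forall>y\<in>M. A (x + y) = A x + A y) \<and>
     (\<forall>c. \<forall>x\<in>M. A (scaleC c x) = scaleC c (A x)) \<and>
     (\<exists>C. \<forall>x\<in>M. norm (A x) \<le> C * norm x)}"

definition adjoint_on :: "'a :: chilbert_space set \<Rightarrow> ('a \<Rightarrow> 'a) \<Rightarrow> 'a \<Rightarrow> 'a" where
  "adjoint_on M A y = (THE z. z \<in> M \<and> (\<forall>x\<in>M. cinner (A x) y = cinner x z))"

abbreviation adj :: "('a :: chilbert_space \<Rightarrow> 'a) \<Rightarrow> 'a \<Rightarrow> 'a" where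
  "adj \<equiv> adjoint_on UNIV"

definition orth_complement :: "'a :: chilbert_space set \<Rightarrow> 'a set" where
  "orth_complement L = {x. \<forall>y\<in>L. cinner x y = 0}"

definition orth_proj :: "'a :: chilbert_space set \<Rightarrow> 'a \<Rightarrow> 'a" where
  "orth_proj M x = (THE y. y \<in> M \<and> x - y \<in> orth_complement M)"

definition positive_op :: "('a :: chilbert_space \<Rightarrow> 'a) \<Rightarrow> bool" where
  "positive_op A \<longleftrightarrow> A \<in> bounded_ops UNIV UNIV \<and>
     (\<forall>x. Im (cinner (A x) x) = 0 \<and> 0 \<le> Re (cinner (A x) x))"

definition sqrt_op :: "('a :: chilbert_space \<Rightarrow> 'a) \<Rightarrow> 'a \<Rightarrow> 'a" where
  "sqrt_op A = (THE R. positive_op R \<and> R \<circ> R = A)"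

definition co_invariant ::
    "'a :: chilbert_space set \<Rightarrow> ('a \<Rightarrow> 'a) set \<Rightarrow> 'a set \<Rightarrow> bool" where
  "co_invariant M \<A> E \<longleftrightarrow> csubspace E \<and> closed E \<and> E \<subseteq> M \<and>
     (\<forall>A\<in>\<A>. \<forall>x\<in>E. adjoint_on M A x \<in> E)"

(* The coarsest topology on B(H) for which all maps A \<mapsto> \<langle>Ax, y\<rangle> are continuous; "euclidean" on
   the function space is the topology of pointwise convergence. *)
definition wot :: "('a :: chilbert_space \<Rightarrow> 'a) topology" where
  "wot = pullback_topology (bounded_ops UNIV UNIV) (\<lambda>A (x, y). cinner (A x) y) euclidean"


section \<open>Row operators and noncommutative polynomials\<close>

primrec word_op :: "('n \<Rightarrow> 'a \<Rightarrow> 'a) \<Rightarrow> 'n list \<Rightarrow> 'a \<Rightarrow> 'a" where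
  "word_op T [] = id"
| "word_op T (i # \<alpha>) = T i \<circ> word_op T \<alpha>"

(* Finitely supported families of coefficients, indexed by words. *)
type_synonym 'n ncpoly = "'n list \<Rightarrow>\<^sub>0 complex"

definition ncpoly_op :: "'n ncpoly \<Rightarrow> ('n \<Rightarrow> 'a :: complex_inner \<Rightarrow> 'a) \<Rightarrow> 'a \<Rightarrow> 'a" where
  "ncpoly_op p T x = (\<Sum>\<alpha>\<in>Poly_Mapping.keys p. scaleC (Poly_Mapping.lookup p \<alpha>) (word_op T \<alpha> x))"

definition row_contraction :: "('n :: finite \<Rightarrow> 'h :: chilbert_space \<Rightarrow> 'h) \<Rightarrow> bool" where
  "row_contraction T \<longleftrightarrow> (\<forall>i. T i \<in> bounded_ops UNIV UNIV) \<and>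
     positive_op (\<lambda>h. h - (\<Sum>i\<in>UNIV. T i (adj (T i) h)))"

definition defect_op :: "('n :: finite \<Rightarrow> 'h :: chilbert_space \<Rightarrow> 'h) \<Rightarrow> 'h \<Rightarrow> 'h" where
  "defect_op T = sqrt_op (\<lambda>h. h - (\<Sum>i\<in>UNIV. T i (adj (T i) h)))"

definition pure_row_contraction :: "('n :: finite \<Rightarrow> 'h :: chilbert_space \<Rightarrow> 'h) \<Rightarrow> bool" where
  "pure_row_contraction T \<longleftrightarrow> row_contraction T \<and>
     (\<forall>h. (\<lambda>k. \<Sum>\<alpha> | length \<alpha> = k. word_op T \<alpha> (adj (word_op T \<alpha>) h)) \<longlonglongrightarrow> 0)"


section \<open>The full Fock space\<close>

(* H_n is complex^'n with its standard basis, so H_n^{\<otimes>k} is the space of families indexed by the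
   words of length k (the coordinates with respect to e_{i_1} \<otimes> ... \<otimes> e_{i_k}), and the orthogonal
   sum over all k consists of the square-summable families indexed by all words; the empty word
   gives the vacuum component. *)
type_synonym 'n fock = "('n list, complex) ell2"

lemma creation_summable:
  fixes x :: "complex ^ 'n :: finite"
  assumes "(\<lambda>w. (norm (\<phi> w :: complex))\<^sup>2) summable_on UNIV"
  shows "(\<lambda>w. (norm (case w of [] \<Rightarrow> 0 | i # v \<Rightarrow> x $ i * \<phi> v))\<^sup>2) summable_on UNIV"
    (is "?f summable_on UNIV")
proof -
  have "?f summable_on (#) i ` UNIV" for i
    by (subst summable_on_reindex)
       (auto simp: o_def norm_mult power_mult_distrib intro!: summable_on_cmult_right assms)
  then have "?f summable_on (\<Union>i. (#) i ` UNIV)"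
    by (intro summable_on_finite_union_disjoint) auto
  moreover have "?f summable_on {[]}" by simp
  ultimately have "?f summable_on ((\<Union>i. (#) i ` UNIV) \<union> {[]})"
    by (rule summable_on_Un_disjoint) auto
  moreover have "(\<Union>i. (#) i ` UNIV) \<union> {[]} = (UNIV :: 'n list set)"
    by (auto simp: image_iff) (metis neq_Nil_conv)
  ultimately show ?thesis by simp
qed

(* x \<otimes> \<phi> for x in H_n. *)
lift_definition fock_tensor :: "complex ^ 'n :: finite \<Rightarrow> 'n fock \<Rightarrow> 'n fock"
  is "\<lambda>x \<phi> w. case w of [] \<Rightarrow> 0 | i # v \<Rightarrow> x $ i * \<phi> v"
  by (simp add: creation_summable)

definition creation :: "'n :: finite \<Rightarrow> 'n fock \<Rightarrow> 'n fock" where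
  "creation i \<phi> = fock_tensor (axis i 1) \<phi>"


section \<open>Noncommutative analytic Toeplitz algebra and its ideals\<close>

definition op_subspace :: "('a :: chilbert_space \<Rightarrow> 'a) set \<Rightarrow> bool" where
  "op_subspace \<A> \<longleftrightarrow> \<A> \<subseteq> bounded_ops UNIV UNIV \<and> (\<lambda>x. 0) \<in> \<A> \<and>
     (\<forall>A\<in>\<A>. \<forall>B\<in>\<A>. (\<lambda>x. A x + B x) \<in> \<A>) \<and>
     (\<forall>c. \<forall>A\<in>\<A>. (\<lambda>x. scaleC c (A x)) \<in> \<A>)"

definition op_algebra :: "('a :: chilbert_space \<Rightarrow> 'a) set \<Rightarrow> bool" where
  "op_algebra \<A> \<longleftrightarrow> op_subspace \<A> \<and> (\<forall>A\<in>\<A>. \<forall>B\<in>\<A>. A \<circ> B \<in> \<A>)"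

definition F_infty :: "('n :: finite fock \<Rightarrow> 'n fock) set" where
  "F_infty = \<Inter>{\<A>. op_algebra \<A> \<and> closedin wot \<A> \<and> id \<in> \<A> \<and> range creation \<subseteq> \<A>}"

definition wot_closed_ideal :: "('n :: finite fock \<Rightarrow> 'n fock) set \<Rightarrow> bool" where
  "wot_closed_ideal J \<longleftrightarrow> op_subspace J \<and> J \<subseteq> F_infty \<and> closedin wot J \<and>
     (\<forall>A\<in>F_infty. \<forall>B\<in>J. A \<circ> B \<in> J \<and> B \<circ> A \<in> J)"

definition wot_ideal_generated_by ::
    "('n :: finite fock \<Rightarrow> 'n fock) set \<Rightarrow> ('n fock \<Rightarrow> 'n fock) set \<Rightarrow> bool" where
  "wot_ideal_generated_by J X \<longleftrightarrow> wot_closed_ideal J \<and> X \<subseteq> J \<and>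
     (\<forall>J'. wot_closed_ideal J' \<and> X \<subseteq> J' \<longrightarrow> J \<subseteq> J')"

definition N_space :: "('n :: finite fock \<Rightarrow> 'n fock) set \<Rightarrow> 'n fock set" where
  "N_space J = orth_complement (closure (cspan {A \<phi> | A \<phi>. A \<in> J}))"

definition constrained_shift ::
    "('n :: finite fock \<Rightarrow> 'n fock) set \<Rightarrow> 'n \<Rightarrow> 'n fock \<Rightarrow> 'n fock" where
  "constrained_shift J i \<phi> = orth_proj (N_space J) (creation i \<phi>)"


section \<open>Hilbert tensor products\<close>

(* The Hilbert tensor product of l^2(I) and H is l^2(I; H), with f \<otimes> h = (f(i) h)_i. *)
lift_definition tensor_vec :: "('i, complex) ell2 \<Rightarrow> 'h :: complex_inner \<Rightarrow> ('i, 'h) ell2"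
  is "\<lambda>f h i. scaleC (f i) h"
  by (simp add: norm_scaleC power_mult_distrib summable_on_cmult_left)

lemma cinner_tensor_vec: "cinner (tensor_vec f h) (tensor_vec g k) = cinner f g * cinner h k"
proof -
  have "cinner (scaleC a h) (scaleC b k) = cinner a b * cinner h k" for a b :: complex
  proof -
    have "cinner (scaleC a h) (scaleC b k) = a * cnj (cinner (scaleC b k) h)"
      by (simp add: cinner_scaleC_left cinner_commute[of h])
    also have "\<dots> = a * cnj b * cnj (cinner k h)"
      by (simp add: cinner_scaleC_left)
    finally show ?thesis
      by (simp add: cinner_complex_def cinner_commute[of h k])
  qed
  then show ?thesis
    by (simp add: cinner_ell2_def tensor_vec.rep_eq infsum_cmult_left')
qed

definition hilbert_tensor ::
    "('i, complex) ell2 set \<Rightarrow> 'h :: chilbert_space set \<Rightarrow> ('i, 'h) ell2 set" where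
  "hilbert_tensor M D = closure (cspan {tensor_vec f d | f d. f \<in> M \<and> d \<in> D})"

(* A \<otimes> I_D for A in B(M).  The condition determines the operator on M \<otimes> D, outside of which its
   values are irrelevant (hence SOME). *)
definition ampliation :: "('i, complex) ell2 set \<Rightarrow> 'h :: chilbert_space set \<Rightarrow>
    (('i, complex) ell2 \<Rightarrow> ('i, complex) ell2) \<Rightarrow> ('i, 'h) ell2 \<Rightarrow> ('i, 'h) ell2" where
  "ampliation M D A = (SOME R. R \<in> bounded_ops (hilbert_tensor M D) (hilbert_tensor M D) \<and>
     (\<forall>f\<in>M. \<forall>d\<in>D. R (tensor_vec f d) = tensor_vec (A f) d))"

end

theory Submission
  imports Defs
begin

text \<open>With \<open>W h = \<Sum>\<^sub>\<alpha> e\<^sub>\<alpha> \<otimes> \<Delta>\<^sub>T T\<^sub>\<alpha>\<^sup>* h\<close> one has \<open>W T\<^sub>i\<^sup>* = (S\<^sub>i\<^sup>* \<otimes> I) W\<close>. The slices of \<open>W h\<close> are orthogonal to the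
  ranges of the polynomials in \<open>P\<close>, and the operators in \<open>F\<^sub>n\<^sup>\<infinity>\<close> with range orthogonal to all slices
  form a WOT-closed ideal, so \<open>W\<close> maps into \<open>N\<^sub>J \<otimes> D\<close>, where \<open>S\<^sub>i\<^sup>* \<otimes> I\<close> and \<open>B\<^sub>i\<^sup>* \<otimes> I\<close> agree.
  The defect \<open>Q = I - W\<^sup>* W\<close> is the strong limit of \<open>\<Sum>\<^bsub>|\<alpha>|=k\<^esub> T\<^sub>\<alpha> T\<^sub>\<alpha>\<^sup>*\<close> and satisfies
  \<open>Q = \<Sum>\<^sub>i T\<^sub>i Q T\<^sub>i\<^sup>*\<close>. Hence \<open>Z\<^sub>i\<^sup>* Q\<^sup>1\<^sup>/\<^sup>2 = Q\<^sup>1\<^sup>/\<^sup>2 T\<^sub>i\<^sup>*\<close> defines operators on the closure \<open>K\<close> of the range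
  of \<open>Q\<^sup>1\<^sup>/\<^sup>2\<close> with \<open>\<Sum>\<^sub>i Z\<^sub>i Z\<^sub>i\<^sup>* = I\<close> that inherit the polynomial relations of \<open>T\<close>, and
  \<open>h \<mapsto> (W h, Q\<^sup>1\<^sup>/\<^sup>2 h)\<close> is the required isometry.\<close>

section \<open>Hilbert space geometry\<close>

text \<open>Splitting \<open>W h\<close> at the empty word gives
  \<open>W^* W = Delta^2 + sum_i T_i W^* W T_i^*\<close>. Subtracted from
  \<open>I = Delta^2 + sum_i T_i T_i^*\<close>, it leaves the fixed point equation of
  \<open>Q\<close>. Written with norms this is
  \<open>sum_i |Q^(1/2) T_i^* h|^2 = |Q^(1/2) h|^2\<close>, and this one identity both makes each
  \<open>Z_i^*\<close> well defined and contractive and makes the row of the \<open>Z_i\<close>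
  coisometric. The polynomial relations are reached through adjoints. Both \<open>A_i = Z_i\<close>
  with \<open>Y = Q^(1/2)\<close> and \<open>A_i = S_i\<close> with \<open>Y\<close> a slice of
  \<open>W\<close> satisfy \<open>A_i^* Y = Y T_i^*\<close>, hence
  \<open>p(A)^* Y = Y p(T)^* = 0\<close>. In the first case density of the range gives
  \<open>p(Z) = 0\<close>; in the second the slices are orthogonal to the range of
  \<open>p(S)\<close>. Elements of \<open>J\<close> and of \<open>F_infty\<close> have no formula in
  terms of generators, so properties reach them only through the minimality of both sets.
  WOT-closedness is therefore needed just for sets cut out by vanishing matrix coefficients.\<close>

lemma cinner_scaleC_right: "cinner x (scaleC c y) = cnj c * cinner x y"
  by (subst cinner_commute, subst cinner_scaleC_left) (simp add: cinner_commute[of y x])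

lemma cinner_add_right: "cinner x (y + z) = cinner x y + cinner x z"
  by (subst cinner_commute, subst cinner_add_left)
     (simp add: cinner_commute[of y x] cinner_commute[of z x])

text \<open>Cauchy-Schwarz follows from the weaker \<open>two_cmod_cinner_le\<close> by normalizing:
  for unit vectors its right-hand side is 2.\<close>

lemma cmod_cinner_le_norm_mult: "cmod (cinner x y) \<le> norm x * norm y"
proof (cases "x = 0 \<or> y = 0")
  case True
  have "cinner 0 y = 0" "cinner x 0 = 0"
    using cinner_scaleC_left[of 0 0 y] cinner_scaleC_right[of x 0 0] by simp_all
  with True show ?thesis by auto
next
  case False
  define u v where "u = (1 / norm x) *\<^sub>R x" and "v = (1 / norm y) *\<^sub>R y"
  have "2 * cmod (cinner u v) \<le> 1 + 1"
    using two_cmod_cinner_le[of u v] False by (simp add: u_def v_def)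
  moreover have "cmod (cinner u v) = cmod (cinner x y) / (norm x * norm y)"
    by (simp add: u_def v_def scaleR_scaleC cinner_scaleC_left cinner_scaleC_right norm_mult norm_divide)
  ultimately show ?thesis using False by (simp add: field_simps)
qed

interpretation cinner: bounded_bilinear "cinner :: 'a :: complex_inner \<Rightarrow> 'a \<Rightarrow> complex"
proof
  show "\<exists>K. \<forall>a b :: 'a. cmod (cinner a b) \<le> norm a * norm b * K"
    by (rule exI[of _ 1]) (simp add: cmod_cinner_le_norm_mult)
qed (simp_all add: cinner_add_left cinner_add_right scaleR_scaleC cinner_scaleC_left
    cinner_scaleC_right scaleR_conv_of_real[symmetric])

lemma norm_square_eq_cinner: "(norm x)\<^sup>2 = Re (cinner x x)"
  by (simp add: cinner_self_eq_norm)

lemma cinner_self_eq_0 [simp]: "cinner x x = 0 \<longleftrightarrow> x = 0"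
  by (simp add: cinner_self_eq_norm)

lemma bounded_linear_scaleC: "bounded_linear (scaleC c)"
proof
  fix r :: real and x y :: 'a
  show "scaleC c (x + y) = scaleC c x + scaleC c y" by (rule scaleC_add_right)
  show "scaleC c (r *\<^sub>R x) = r *\<^sub>R scaleC c x" by (simp add: scaleR_scaleC scaleC_scaleC mult.commute)
  show "\<exists>K. \<forall>x :: 'a. norm (scaleC c x) \<le> norm x * K"
    by (rule exI[of _ "cmod c"]) (simp add: norm_scaleC)
qed

lemma norm_diff_square: "(norm (x - y))\<^sup>2 = (norm x)\<^sup>2 + (norm y)\<^sup>2 - 2 * Re (cinner x y)"
  for x y :: "'a :: complex_inner"
  using cinner_expand[of x "- y"] by (simp add: cinner.minus_right)

lemma parallelogram_law:
  "(norm (x + y))\<^sup>2 + (norm (x - y))\<^sup>2 = 2 * (norm x)\<^sup>2 + 2 * (norm y)\<^sup>2"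
  for x y :: "'a :: complex_inner"
  by (simp add: cinner_expand norm_diff_square)

lemma csubspace_scaleR: "csubspace M \<Longrightarrow> x \<in> M \<Longrightarrow> r *\<^sub>R x \<in> M"
  by (simp add: scaleR_scaleC complex_vector.subspace_scale)

lemma csubspace_closure:
  assumes "csubspace M"
  shows "csubspace (closure M)"
proof (rule complex_vector.subspaceI)
  show "0 \<in> closure M"
    using complex_vector.subspace_0[OF assms] closure_subset by blast
  show "x + y \<in> closure M" if xy: "x \<in> closure M" "y \<in> closure M" for x y
  proof -
    obtain f g where f: "\<forall>n. f n \<in> M" "f \<longlonglongrightarrow> x" and g: "\<forall>n. g n \<in> M" "g \<longlonglongrightarrow> y"
      using xy unfolding closure_sequential by metis
    have "(\<lambda>n. f n + g n) \<longlonglongrightarrow> x + y" by (intro tendsto_add f g)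
    moreover have "\<forall>n. f n + g n \<in> M" using f g assms by (simp add: complex_vector.subspace_add)
    ultimately show ?thesis unfolding closure_sequential by (intro exI[of _ "\<lambda>n. f n + g n"]) auto
  qed
  show "scaleC c x \<in> closure M" if x: "x \<in> closure M" for c x
  proof -
    obtain f where f: "\<And>n. f n \<in> M" "f \<longlonglongrightarrow> x"
      using x unfolding closure_sequential by auto
    have "(\<lambda>n. scaleC c (f n)) \<longlonglongrightarrow> scaleC c x"
      by (intro bounded_linear.tendsto[OF bounded_linear_scaleC] f)
    moreover have "\<forall>n. scaleC c (f n) \<in> M" using f assms by (simp add: complex_vector.subspace_scale)
    ultimately show ?thesis unfolding closure_sequential by (intro exI[of _ "\<lambda>n. scaleC c (f n)"]) auto
  qed
qed

lemma closure_cspan_subset: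
  "csubspace M \<Longrightarrow> closed M \<Longrightarrow> S \<subseteq> M \<Longrightarrow> closure (cspan S) \<subseteq> M"
  by (intro closure_minimal complex_vector.span_minimal)

lemma nearest_point_exists:
  fixes M :: "'a :: chilbert_space set"
  assumes M: "csubspace M" "closed M"
  shows "\<exists>m\<in>M. \<forall>y\<in>M. norm (x - m) \<le> norm (x - y)"
proof -
  define d where "d = (INF y\<in>M. norm (x - y))"
  have ne: "M \<noteq> {}" using complex_vector.subspace_0[OF M(1)] by auto
  have bdd: "bdd_below ((\<lambda>y. norm (x - y)) ` M)" by (rule bdd_belowI2[of _ 0]) simp
  have d_le: "d \<le> norm (x - y)" if "y \<in> M" for y
    unfolding d_def using bdd that by (rule cINF_lower)
  have d0: "0 \<le> d" unfolding d_def using ne by (intro cINF_greatest) auto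
  have "\<exists>m\<in>M. norm (x - m) < d + 1 / Suc n" for n
    using cINF_less_iff[OF ne bdd, of "d + 1 / Suc n"] by (simp add: d_def)
  then obtain m where m: "\<And>n. m n \<in> M" and md: "\<And>n. norm (x - m n) < d + 1 / Suc n" by metis
  have lim: "(\<lambda>n. norm (x - m n)) \<longlonglongrightarrow> d"
  proof (rule tendsto_sandwich[where f = "\<lambda>_. d" and h = "\<lambda>n. d + 1 / Suc n"])
    have "(\<lambda>n. 1 / real (Suc n)) \<longlonglongrightarrow> 0" using LIMSEQ_inverse_real_of_nat by (simp add: inverse_eq_divide)
    then show "(\<lambda>n. d + 1 / real (Suc n)) \<longlonglongrightarrow> d" using tendsto_add[OF tendsto_const, of _ 0 _ d] by simp
  qed (use d_le m md in \<open>auto intro!: always_eventually less_imp_le\<close>)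
  \<comment> \<open>The midpoint of two almost nearest points is no closer than \<open>d\<close>, so the parallelogram law bounds their distance.\<close>
  have gap: "(norm (m i - m j))\<^sup>2 \<le> 2 * ((norm (x - m i))\<^sup>2 - d\<^sup>2) + 2 * ((norm (x - m j))\<^sup>2 - d\<^sup>2)" for i j
  proof -
    have "(1/2) *\<^sub>R (m i + m j) \<in> M" by (intro csubspace_scaleR complex_vector.subspace_add M m)
    then have "d\<^sup>2 \<le> (norm (x - (1/2) *\<^sub>R (m i + m j)))\<^sup>2" using d_le d0 by (intro power_mono) auto
    moreover have "(x - m i) + (x - m j) = 2 *\<^sub>R (x - (1/2) *\<^sub>R (m i + m j))"
      by (simp add: algebra_simps scaleR_2)
    then have "(norm ((x - m i) + (x - m j)))\<^sup>2 = 4 * (norm (x - (1/2) *\<^sub>R (m i + m j)))\<^sup>2"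
      by (simp add: power_mult_distrib)
    moreover have "(x - m i) - (x - m j) = m j - m i" by simp
    ultimately show ?thesis
      using parallelogram_law[of "x - m i" "x - m j"] by (simp add: norm_minus_commute)
  qed
  have "Cauchy m"
  proof (rule metric_CauchyI)
    fix e :: real assume e: "0 < e"
    have "(\<lambda>n. (norm (x - m n))\<^sup>2 - d\<^sup>2) \<longlonglongrightarrow> 0"
      using tendsto_diff[OF tendsto_power[OF lim, of 2] tendsto_const[of "d\<^sup>2"]] by simp
    then have "\<forall>\<^sub>F n in sequentially. (norm (x - m n))\<^sup>2 - d\<^sup>2 < e\<^sup>2 / 4"
      by (rule order_tendstoD) (use e in auto)
    then obtain N where N: "\<And>n. N \<le> n \<Longrightarrow> (norm (x - m n))\<^sup>2 - d\<^sup>2 < e\<^sup>2 / 4"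
      by (auto simp: eventually_sequentially)
    have "dist (m i) (m j) < e" if "N \<le> i" "N \<le> j" for i j
    proof -
      have "(norm (m i - m j))\<^sup>2 < e\<^sup>2" using gap[of i j] N[OF that(1)] N[OF that(2)] by simp
      then show ?thesis using e by (simp add: dist_norm power_less_imp_less_base less_imp_le)
    qed
    then show "\<exists>N. \<forall>i\<ge>N. \<forall>j\<ge>N. dist (m i) (m j) < e" by blast
  qed
  then obtain l where l: "m \<longlonglongrightarrow> l" using Cauchy_convergent convergent_def by blast
  have "l \<in> M" using M(2) m l by (rule closed_sequentially)
  moreover have "norm (x - l) = d"
    using LIMSEQ_unique[OF tendsto_norm[OF tendsto_diff[OF tendsto_const l]] lim] .
  ultimately show ?thesis using d_le by auto
qed

section \<open>Orthogonal complements and projections onto closed subspaces\<close>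

lemma csubspace_orth_complement: "csubspace (orth_complement L)"
  by (rule complex_vector.subspaceI)
     (auto simp: orth_complement_def cinner_add_left cinner_scaleC_left cinner.zero_left)

lemma closed_orth_complement: "closed (orth_complement (L :: 'a :: chilbert_space set))"
proof -
  have "closed {x. cinner x y = 0}" for y :: 'a
    by (intro closed_Collect_eq continuous_intros cinner.continuous_on)
  moreover have "orth_complement L = (\<Inter>y\<in>L. {x. cinner x y = 0})"
    by (auto simp: orth_complement_def)
  ultimately show ?thesis by auto
qed

lemma orthogonal_decomposition:
  fixes M :: "'a :: chilbert_space set"
  assumes M: "csubspace M" "closed M"
  shows "\<exists>!y. y \<in> M \<and> x - y \<in> orth_complement M"
proof (rule ex_ex1I)
  obtain m where m: "m \<in> M" "\<And>y. y \<in> M \<Longrightarrow> norm (x - m) \<le> norm (x - y)"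
    using nearest_point_exists[OF M] by blast
  have "cinner (x - m) z = 0" if z: "z \<in> M" for z
  proof (cases "z = 0")
    case False
    \<comment> \<open>\<open>scaleC c z\<close> is the projection of \<open>x - m\<close> onto the
      line through \<open>z\<close>. Moving \<open>m\<close> by it lowers the squared distance by
      \<open>|c|^2 |z|^2\<close>, so minimality of \<open>m\<close> forces
      \<open>c = 0\<close>.\<close>
    define c where "c = cinner (x - m) z / complex_of_real ((norm z)\<^sup>2)"
    have "m + scaleC c z \<in> M" by (intro complex_vector.subspace_add complex_vector.subspace_scale M m z)
    then have "(norm (x - m))\<^sup>2 \<le> (norm ((x - m) - scaleC c z))\<^sup>2"
      using m(2) by (intro power_mono) (auto simp: algebra_simps)
    also have "\<dots> = (norm (x - m))\<^sup>2 + (cmod c)\<^sup>2 * (norm z)\<^sup>2 - 2 * Re (cnj c * cinner (x - m) z)"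
      by (simp add: norm_diff_square norm_scaleC power_mult_distrib cinner_scaleC_right)
    also have "cinner (x - m) z = c * complex_of_real ((norm z)\<^sup>2)" using False by (simp add: c_def)
    also have "Re (cnj c * (c * complex_of_real ((norm z)\<^sup>2))) = (cmod c)\<^sup>2 * (norm z)\<^sup>2"
      by (simp only: mult.assoc[symmetric] mult.commute[of "cnj c"] complex_norm_square[symmetric] of_real_mult[symmetric] Re_complex_of_real)
    finally have "(cmod c)\<^sup>2 * (norm z)\<^sup>2 \<le> 0" by (simp add: mult.commute)
    then have "c = 0" using False by (simp add: mult_le_0_iff)
    then show ?thesis using False by (simp add: c_def)
  qed (simp add: cinner.zero_right)
  then show "\<exists>y. y \<in> M \<and> x - y \<in> orth_complement M" using m(1) by (auto simp: orth_complement_def)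
next
  fix y z
  assume y: "y \<in> M \<and> x - y \<in> orth_complement M" and z: "z \<in> M \<and> x - z \<in> orth_complement M"
  have "y - z \<in> M" using y z M by (simp add: complex_vector.subspace_diff)
  moreover have "(x - z) - (x - y) \<in> orth_complement M"
    using complex_vector.subspace_diff[OF csubspace_orth_complement] y z by blast
  ultimately have "cinner (y - z) (y - z) = 0" by (simp add: orth_complement_def)
  then show "y = z" by simp
qed

context
  fixes M :: "'a :: chilbert_space set"
  assumes M: "csubspace M" "closed M"
begin

lemma orth_proj_in: "orth_proj M x \<in> M"
  and orth_proj_residual: "x - orth_proj M x \<in> orth_complement M"
  using theI'[OF orthogonal_decomposition[OF M, of x]] by (auto simp: orth_proj_def)

lemma cinner_orth_proj: "y \<in> M \<Longrightarrow> cinner (orth_proj M x) y = cinner x y"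
  using orth_proj_residual[of x] by (simp add: orth_complement_def cinner.diff_left)

lemma orth_proj_eqI: "y \<in> M \<Longrightarrow> x - y \<in> orth_complement M \<Longrightarrow> orth_proj M x = y"
  using orthogonal_decomposition[OF M, of x] orth_proj_in orth_proj_residual by blast

lemma norm_orth_proj_le: "norm (orth_proj M x) \<le> norm x"
proof -
  have "(norm (orth_proj M x))\<^sup>2 = cmod (cinner x (orth_proj M x))"
    using cinner_orth_proj[OF orth_proj_in, of x x] by (metis cinner_self_eq_norm norm_of_real abs_power2)
  also have "\<dots> \<le> norm x * norm (orth_proj M x)" by (rule cmod_cinner_le_norm_mult)
  finally show ?thesis by (simp add: power2_eq_square mult_le_cancel_right)
     (metis norm_ge_zero norm_zero order_le_less)
qed

lemma orth_proj_add: "orth_proj M (x + y) = orth_proj M x + orth_proj M y"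
proof (rule orth_proj_eqI)
  have "(x - orth_proj M x) + (y - orth_proj M y) \<in> orth_complement M"
    by (intro complex_vector.subspace_add csubspace_orth_complement orth_proj_residual)
  then show "x + y - (orth_proj M x + orth_proj M y) \<in> orth_complement M" by (simp add: algebra_simps)
qed (intro complex_vector.subspace_add M orth_proj_in)

lemma orth_proj_scaleC: "orth_proj M (scaleC c x) = scaleC c (orth_proj M x)"
proof (rule orth_proj_eqI)
  have "scaleC c (x - orth_proj M x) \<in> orth_complement M"
    by (intro complex_vector.subspace_scale csubspace_orth_complement orth_proj_residual)
  then show "scaleC c x - scaleC c (orth_proj M x) \<in> orth_complement M"
    by (simp add: complex_vector.scale_right_diff_distrib)
qed (intro complex_vector.subspace_scale M orth_proj_in)

end

text \<open>Linearity and boundedness are asked for on \<open>M\<close> only, because an operator on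
  a subspace is a function with arbitrary values elsewhere. Unless \<open>f\<close> vanishes on
  \<open>M\<close>, the vector is taken orthogonal to the kernel of \<open>f\<close> in
  \<open>M\<close>, which has codimension one.\<close>

lemma Riesz_representation:
  fixes M :: "'a :: chilbert_space set" and f :: "'a \<Rightarrow> complex"
  assumes M: "csubspace M" "closed M"
    and add: "\<And>x y. x \<in> M \<Longrightarrow> y \<in> M \<Longrightarrow> f (x + y) = f x + f y"
    and scale: "\<And>c x. x \<in> M \<Longrightarrow> f (scaleC c x) = c * f x"
    and bound: "\<And>x. x \<in> M \<Longrightarrow> cmod (f x) \<le> C * norm x"
  shows "\<exists>z\<in>M. \<forall>x\<in>M. f x = cinner x z"
proof (cases "\<forall>x\<in>M. f x = 0")
  case True
  then show ?thesis using complex_vector.subspace_0[OF M(1)] by (auto simp: cinner.zero_right intro!: bexI[of _ 0])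
next
  case False
  then obtain u where u: "u \<in> M" "f u \<noteq> 0" by blast
  define N where "N = {x \<in> M. f x = 0}"
  have diff: "f (x - y) = f x - f y" if "x \<in> M" "y \<in> M" for x y
    using add[of "x - y" y] that M(1) by (simp add: complex_vector.subspace_diff)
  have N: "csubspace N"
    using scale[of 0 0] complex_vector.subspace_0[OF M(1)] add scale M(1) unfolding N_def
    by (intro complex_vector.subspaceI)
       (auto simp: complex_vector.subspace_add complex_vector.subspace_scale)
  have "closed N" unfolding closed_sequential_limits
  proof safe
    fix x l assume x: "\<forall>n. x n \<in> N" and l: "x \<longlonglongrightarrow> l"
    have lM: "l \<in> M" using closed_sequentially[OF M(2) _ l] x by (auto simp: N_def)
    have "(\<lambda>n. C * norm (l - x n)) \<longlonglongrightarrow> C * norm (l - l)" by (intro tendsto_intros l)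
    moreover have "cmod (f l) \<le> C * norm (l - x n)" for n
      using bound[of "l - x n"] diff[OF lM, of "x n"] x lM M(1)
      by (simp add: N_def complex_vector.subspace_diff)
    ultimately have "cmod (f l) \<le> C * norm (l - l)" by (meson LIMSEQ_le_const)
    then show "l \<in> N" using lM by (simp add: N_def)
  qed
  note proj = orth_proj_in[OF N this] orth_proj_residual[OF N this]
  define w where "w = u - orth_proj N u"
  have wM: "w \<in> M" using u proj(1)[of u] M(1) by (auto simp: w_def N_def intro: complex_vector.subspace_diff)
  have fw: "f w \<noteq> 0" using u proj(1)[of u] diff by (auto simp: w_def N_def)
  then have w0: "w \<noteq> 0" using scale[of 0 0] complex_vector.subspace_0[OF M(1)] by auto
  \<comment> \<open>The factor is chosen so that \<open>cinner w z = f w\<close>; every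
    \<open>x\<close> in \<open>M\<close> differs from a multiple of \<open>w\<close> by an element
    of \<open>N\<close>.\<close>
  define z where "z = scaleC (cnj (f w) / complex_of_real ((norm w)\<^sup>2)) w"
  have "f x = cinner x z" if x: "x \<in> M" for x
  proof -
    have "x - scaleC (f x / f w) w \<in> N"
      using x wM fw M(1) by (simp add: N_def diff scale complex_vector.subspace_scale complex_vector.subspace_diff)
    then have "cinner w (x - scaleC (f x / f w) w) = 0"
      using proj(2)[of u] by (simp add: orth_complement_def w_def)
    then have "cinner (x - scaleC (f x / f w) w) w = 0"
      by (subst cinner_commute) simp
    then have "cinner x w = f x / f w * complex_of_real ((norm w)\<^sup>2)"
      by (simp add: cinner.diff_left cinner_scaleC_left cinner_self_eq_norm)
    then show ?thesis using fw w0 by (simp add: z_def cinner_scaleC_right)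
  qed
  moreover have "z \<in> M" using wM M(1) by (simp add: z_def complex_vector.subspace_scale)
  ultimately show ?thesis by blast
qed

section \<open>Bounded operators and adjoints\<close>

lemma bounded_opsI:
  assumes "\<And>x. x \<in> M \<Longrightarrow> A x \<in> N"
    and "\<And>x y. x \<in> M \<Longrightarrow> y \<in> M \<Longrightarrow> A (x + y) = A x + A y"
    and "\<And>c x. x \<in> M \<Longrightarrow> A (scaleC c x) = scaleC c (A x)"
    and "\<And>x. x \<in> M \<Longrightarrow> norm (A x) \<le> C * norm x"
  shows "A \<in> bounded_ops M N"
  using assms unfolding bounded_ops_def by blast

lemma bounded_opsD:
  assumes "A \<in> bounded_ops M N"
  shows "x \<in> M \<Longrightarrow> A x \<in> N"
    and "x \<in> M \<Longrightarrow> y \<in> M \<Longrightarrow> A (x + y) = A x + A y"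
    and "x \<in> M \<Longrightarrow> A (scaleC c x) = scaleC c (A x)"
  using assms unfolding bounded_ops_def by blast+

lemma bounded_ops_bound:
  assumes "A \<in> bounded_ops M N"
  obtains C where "0 \<le> C" "\<And>x. x \<in> M \<Longrightarrow> norm (A x) \<le> C * norm x"
proof -
  obtain C where C: "\<forall>x\<in>M. norm (A x) \<le> C * norm x" using assms unfolding bounded_ops_def by blast
  have "norm (A x) \<le> \<bar>C\<bar> * norm x" if "x \<in> M" for x
    using C that mult_right_mono[OF abs_ge_self[of C] norm_ge_zero[of x]] by fastforce
  then show ?thesis using that[of "\<bar>C\<bar>"] by simp
qed

lemma bounded_ops_diff:
  assumes "A \<in> bounded_ops M N" "csubspace M" "x \<in> M" "y \<in> M"
  shows "A (x - y) = A x - A y"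
  using bounded_opsD(2)[OF assms(1), of "x - y" y] assms by (simp add: complex_vector.subspace_diff)

lemma bounded_ops_continuous_on:
  assumes "A \<in> bounded_ops M N" "csubspace M"
  shows "continuous_on M A"
proof -
  obtain C where C: "0 \<le> C" "\<And>x. x \<in> M \<Longrightarrow> norm (A x) \<le> C * norm x"
    using bounded_ops_bound[OF assms(1)] by metis
  have "C-lipschitz_on M A"
    using C assms by (intro lipschitz_onI)
      (auto simp: dist_norm bounded_ops_diff[OF assms, symmetric] complex_vector.subspace_diff)
  then show ?thesis by (rule lipschitz_on_continuous_on)
qed

lemma bounded_ops_imp_bounded_linear:
  assumes "A \<in> bounded_ops UNIV N"
  shows "bounded_linear A"
proof -
  obtain C where "\<And>x. norm (A x) \<le> C * norm x" using bounded_ops_bound[OF assms] by auto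
  then show ?thesis
    using bounded_opsD(2,3)[OF assms]
    by (intro bounded_linear_intro[of A C]) (auto simp: scaleR_scaleC mult.commute)
qed

lemma bounded_ops_id: "id \<in> bounded_ops M M"
  by (rule bounded_opsI[where C = 1]) auto

lemma bounded_ops_comp:
  assumes A: "A \<in> bounded_ops N L" and B: "B \<in> bounded_ops M N"
  shows "A \<circ> B \<in> bounded_ops M L"
proof -
  obtain C D where C: "0 \<le> C" "\<And>x. x \<in> N \<Longrightarrow> norm (A x) \<le> C * norm x"
    and D: "0 \<le> D" "\<And>x. x \<in> M \<Longrightarrow> norm (B x) \<le> D * norm x"
    using bounded_ops_bound[OF A] bounded_ops_bound[OF B] by metis
  show ?thesis
  proof (rule bounded_opsI[where C = "C * D"])
    fix x assume x: "x \<in> M"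
    have "norm (A (B x)) \<le> C * norm (B x)" using x by (intro C bounded_opsD(1)[OF B])
    also have "\<dots> \<le> C * (D * norm x)" using x by (intro mult_left_mono C D)
    finally show "norm ((A \<circ> B) x) \<le> C * D * norm x" by (simp add: mult.assoc)
  qed (auto simp: bounded_opsD[OF A] bounded_opsD[OF B])
qed

lemma bounded_ops_zero: "0 \<in> N \<Longrightarrow> (\<lambda>x. 0) \<in> bounded_ops M N"
  by (rule bounded_opsI[where C = 0]) (auto simp: complex_vector.scale_zero_right)

lemma bounded_ops_add:
  assumes A: "A \<in> bounded_ops M N" and B: "B \<in> bounded_ops M N" and N: "csubspace N"
  shows "(\<lambda>x. A x + B x) \<in> bounded_ops M N"
proof -
  obtain C D where C: "0 \<le> C" "\<And>x. x \<in> M \<Longrightarrow> norm (A x) \<le> C * norm x"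
    and D: "0 \<le> D" "\<And>x. x \<in> M \<Longrightarrow> norm (B x) \<le> D * norm x"
    using bounded_ops_bound[OF A] bounded_ops_bound[OF B] by metis
  show ?thesis
  proof (rule bounded_opsI[where C = "C + D"])
    show "norm (A x + B x) \<le> (C + D) * norm x" if "x \<in> M" for x
      using C(2)[OF that] D(2)[OF that] norm_triangle_ineq[of "A x" "B x"] by (simp add: distrib_right)
  qed (auto simp: bounded_opsD[OF A] bounded_opsD[OF B] scaleC_add_right algebra_simps
      intro: complex_vector.subspace_add[OF N])
qed

lemma bounded_ops_scaleC:
  assumes A: "A \<in> bounded_ops M N" and N: "csubspace N"
  shows "(\<lambda>x. scaleC c (A x)) \<in> bounded_ops M N"
proof -
  obtain C where C: "0 \<le> C" "\<And>x. x \<in> M \<Longrightarrow> norm (A x) \<le> C * norm x"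
    using bounded_ops_bound[OF A] by metis
  show ?thesis
  proof (rule bounded_opsI[where C = "cmod c * C"])
    show "norm (scaleC c (A x)) \<le> cmod c * C * norm x" if "x \<in> M" for x
      using mult_left_mono[OF C(2)[OF that], of "cmod c"] by (simp add: norm_scaleC mult.assoc)
  qed (auto simp: bounded_opsD[OF A] scaleC_add_right scaleC_scaleC mult.commute
      intro: complex_vector.subspace_scale[OF N])
qed

lemma bounded_ops_sum:
  assumes "\<And>i. i \<in> I \<Longrightarrow> A i \<in> bounded_ops M N" and N: "csubspace N"
  shows "(\<lambda>x. \<Sum>i\<in>I. A i x) \<in> bounded_ops M N"
  using assms(1)
proof (induction I rule: infinite_finite_induct)
  case (insert i I)
  then show ?case using bounded_ops_add[OF _ _ N, of "A i" M "\<lambda>x. \<Sum>i\<in>I. A i x"] by simp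
qed (simp_all add: bounded_ops_zero complex_vector.subspace_0[OF N])

text \<open>The codomain is a type of its own, so that besides operators on one space this covers
  \<open>W\<close>, which maps into families indexed by words.\<close>

lemma adjoint_exists:
  fixes A :: "'a :: chilbert_space \<Rightarrow> 'b :: complex_inner"
  assumes A: "A \<in> bounded_ops M N" and M: "csubspace M" "closed M"
  shows "\<exists>z\<in>M. \<forall>x\<in>M. cinner (A x) y = cinner x z"
proof -
  obtain C where C: "0 \<le> C" "\<And>x. x \<in> M \<Longrightarrow> norm (A x) \<le> C * norm x"
    using bounded_ops_bound[OF A] by metis
  show ?thesis
  proof (rule Riesz_representation[OF M, where C = "C * norm y"])
    fix x assume x: "x \<in> M"
    have "cmod (cinner (A x) y) \<le> norm (A x) * norm y" by (rule cmod_cinner_le_norm_mult)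
    also have "\<dots> \<le> C * norm x * norm y" using C(2)[OF x] by (rule mult_right_mono) simp
    finally show "cmod (cinner (A x) y) \<le> C * norm y * norm x" by (simp add: mult_ac)
  qed (simp_all add: bounded_opsD[OF A] cinner_add_left cinner_scaleC_left)
qed

lemma eq_if_cinner_eq:
  assumes M: "csubspace M" and "z \<in> M" "w \<in> M" "\<And>x. x \<in> M \<Longrightarrow> cinner x z = cinner x w"
  shows "z = w"
proof -
  have "cinner (z - w) (z - w) = 0"
    using assms complex_vector.subspace_diff[OF M, of z w] by (simp add: cinner.diff_right)
  then show ?thesis by simp
qed

lemma adjoint_on_eqI:
  assumes "csubspace M" "z \<in> M" "\<And>x. x \<in> M \<Longrightarrow> cinner (A x) y = cinner x z"
  shows "adjoint_on M A y = z"
  unfolding adjoint_on_def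
proof (rule the_equality)
  fix w assume w: "w \<in> M \<and> (\<forall>x\<in>M. cinner (A x) y = cinner x w)"
  then show "w = z" using assms by (intro eq_if_cinner_eq[OF assms(1)]) auto
qed (use assms in auto)

context
  fixes M :: "'a :: chilbert_space set" and A
  assumes A: "A \<in> bounded_ops M M" and M: "csubspace M" "closed M"
begin

lemma adjoint_on_in: "adjoint_on M A y \<in> M"
  and cinner_adjoint_on: "x \<in> M \<Longrightarrow> cinner (A x) y = cinner x (adjoint_on M A y)"
proof -
  obtain z where z: "z \<in> M" "\<forall>x\<in>M. cinner (A x) y = cinner x z"
    using adjoint_exists[OF A M] by blast
  then have "adjoint_on M A y = z" by (intro adjoint_on_eqI M) auto
  with z show "adjoint_on M A y \<in> M" "x \<in> M \<Longrightarrow> cinner (A x) y = cinner x (adjoint_on M A y)"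
    by auto
qed

lemma adjoint_on_bounded_ops: "adjoint_on M A \<in> bounded_ops M M"
proof -
  obtain C where C: "0 \<le> C" "\<And>x. x \<in> M \<Longrightarrow> norm (A x) \<le> C * norm x"
    using bounded_ops_bound[OF A] by metis
  show ?thesis
  proof (rule bounded_opsI[where C = C])
    fix x y c assume xy: "x \<in> M" "y \<in> M"
    show "adjoint_on M A (x + y) = adjoint_on M A x + adjoint_on M A y"
      by (intro adjoint_on_eqI M complex_vector.subspace_add adjoint_on_in)
         (simp add: cinner_adjoint_on cinner_add_right)
  next
    fix x c
    show "adjoint_on M A (scaleC c x) = scaleC c (adjoint_on M A x)"
      by (intro adjoint_on_eqI M complex_vector.subspace_scale adjoint_on_in)
         (simp add: cinner_adjoint_on cinner_scaleC_right)
  next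
    fix x assume "x \<in> M"
    let ?z = "adjoint_on M A x"
    have "(norm ?z)\<^sup>2 = cmod (cinner (A ?z) x)"
      by (simp add: cinner_adjoint_on adjoint_on_in cinner_self_eq_norm norm_power)
    also have "\<dots> \<le> norm (A ?z) * norm x" by (rule cmod_cinner_le_norm_mult)
    also have "\<dots> \<le> C * norm ?z * norm x" by (intro mult_right_mono C adjoint_on_in) simp
    finally have "norm ?z * norm ?z \<le> norm ?z * (C * norm x)" by (simp add: power2_eq_square mult_ac)
    then show "norm ?z \<le> C * norm x"
      using C(1) by (cases "norm ?z = 0") (simp_all add: mult_le_cancel_left)
  qed (rule adjoint_on_in)
qed

lemma adjoint_on_adjoint_on: "x \<in> M \<Longrightarrow> adjoint_on M (adjoint_on M A) x = A x"
proof (intro adjoint_on_eqI M)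
  show "cinner (adjoint_on M A y) x = cinner y (A x)" if "x \<in> M" "y \<in> M" for y
    using cinner_adjoint_on[OF that(1), of y] by (subst (1 2) cinner_commute) simp
qed (rule bounded_opsD(1)[OF A])

end

lemma cinner_adj: "A \<in> bounded_ops UNIV UNIV \<Longrightarrow> cinner (A x) y = cinner x (adj A y)"
  by (rule cinner_adjoint_on) (auto simp: complex_vector.subspace_UNIV)

lemma adj_bounded_ops: "A \<in> bounded_ops UNIV UNIV \<Longrightarrow> adj A \<in> bounded_ops UNIV UNIV"
  by (rule adjoint_on_bounded_ops) (auto simp: complex_vector.subspace_UNIV)

lemma cinner_eqI: "(\<And>x. cinner x z = cinner x w) \<Longrightarrow> z = w"
  by (rule eq_if_cinner_eq[of UNIV]) (auto simp: complex_vector.subspace_UNIV)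

lemma adj_comp:
  assumes "A \<in> bounded_ops UNIV UNIV" "B \<in> bounded_ops UNIV UNIV"
  shows "adj (A \<circ> B) x = adj B (adj A x)"
  by (rule cinner_eqI) (simp add: cinner_adj[symmetric] bounded_ops_comp[OF assms] assms)

lemma cinner_closure_range_eq_0:
  assumes "\<And>h. cinner x (X h) = 0" "y \<in> closure (range X)"
  shows "cinner x y = 0"
proof -
  have "closed {y. cinner x y = 0}"
    by (intro closed_Collect_eq continuous_intros cinner.continuous_on)
  then have "closure (range X) \<subseteq> {y. cinner x y = 0}"
    using assms(1) by (intro closure_minimal) auto
  then show ?thesis using assms(2) by blast
qed

lemma csubspace_range:
  assumes "X \<in> bounded_ops UNIV N"
  shows "csubspace (range X)"
proof (rule complex_vector.subspaceI)
  show "0 \<in> range X"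
    using bounded_opsD(3)[OF assms, of 0 0] by (intro image_eqI[of _ _ 0]) auto
  show "x + y \<in> range X" if "x \<in> range X" "y \<in> range X" for x y
    using that by (auto simp: bounded_opsD(2)[OF assms, symmetric])
  show "scaleC c x \<in> range X" if "x \<in> range X" for c x
    using that by (auto simp: bounded_opsD(3)[OF assms, symmetric])
qed

text \<open>The extension of \<open>X h \<mapsto> Y h\<close> is read off from the closure of its graph.\<close>

lemma extend_dominated_operator:
  fixes X :: "'h :: complex_inner \<Rightarrow> 'b :: chilbert_space" and Y :: "'h \<Rightarrow> 'c :: chilbert_space"
  assumes X: "X \<in> bounded_ops UNIV UNIV" and Y: "Y \<in> bounded_ops UNIV UNIV"
    and le: "\<And>h. norm (Y h) \<le> norm (X h)"
  obtains L where "L \<in> bounded_ops (closure (range X)) (closure (range Y))" "\<And>h. L (X h) = Y h"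
proof -
  let ?K = "closure (range X)"
  define G where "G = closure (range (\<lambda>h. (X h, Y h)))"
  have "csubspace (range (\<lambda>h. (X h, Y h)))"
  proof (rule complex_vector.subspaceI)
    show "0 \<in> range (\<lambda>h. (X h, Y h))"
      using linear_0[OF bounded_linear.linear[OF bounded_ops_imp_bounded_linear[OF X]]]
        linear_0[OF bounded_linear.linear[OF bounded_ops_imp_bounded_linear[OF Y]]]
      by (intro image_eqI[of _ _ 0]) (auto simp: zero_prod_def)
    show "x + y \<in> range (\<lambda>h. (X h, Y h))"
      if "x \<in> range (\<lambda>h. (X h, Y h))" "y \<in> range (\<lambda>h. (X h, Y h))" for x y
      using that by (auto simp: bounded_opsD(2)[OF X, symmetric] bounded_opsD(2)[OF Y, symmetric])
    show "scaleC c x \<in> range (\<lambda>h. (X h, Y h))" if "x \<in> range (\<lambda>h. (X h, Y h))" for c x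
      using that
      by (auto simp: scaleC_prod_def bounded_opsD(3)[OF X, symmetric] bounded_opsD(3)[OF Y, symmetric])
  qed
  then have Gsub: "csubspace G" unfolding G_def by (rule csubspace_closure)
  \<comment> \<open>Domination is a closed condition on pairs and so passes to \<open>G\<close>.
    Applied to the difference of two pairs with the same first entry, it forces equal second
    entries; applied to a single pair, it bounds the extension by 1.\<close>
  have Gbound: "norm (snd p) \<le> norm (fst p)" if "p \<in> G" for p
  proof -
    have "closed {p :: 'b \<times> 'c. norm (snd p) \<le> norm (fst p)}"
      by (intro closed_Collect_le continuous_intros)
    then have "G \<subseteq> {p. norm (snd p) \<le> norm (fst p)}"
      unfolding G_def using le by (intro closure_minimal) auto
    then show ?thesis using that by blast
  qed
  have Gex: "\<exists>y. (x, y) \<in> G" if x: "x \<in> ?K" for x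
  proof -
    obtain f where f: "\<forall>n. f n \<in> range X" "f \<longlonglongrightarrow> x"
      using x unfolding closure_sequential by metis
    then have "\<forall>n. \<exists>h. f n = X h" by blast
    then obtain h where "\<forall>n. f n = X (h n)" by metis
    then have "f = (\<lambda>n. X (h n))" by blast
    with f have h: "(\<lambda>n. X (h n)) \<longlonglongrightarrow> x" by simp
    have dY: "dist (Y (h m)) (Y (h n)) \<le> dist (X (h m)) (X (h n))" for m n
      using le[of "h m - h n"]
      by (simp add: dist_norm bounded_ops_diff[OF X complex_vector.subspace_UNIV]
          bounded_ops_diff[OF Y complex_vector.subspace_UNIV])
    have "Cauchy (\<lambda>n. X (h n))" using h by (intro convergent_Cauchy) (auto simp: convergent_def)
    then have "Cauchy (\<lambda>n. Y (h n))" unfolding Cauchy_def using dY by (meson order_le_less_trans)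
    then obtain y where "(\<lambda>n. Y (h n)) \<longlonglongrightarrow> y" using Cauchy_convergent convergent_def by blast
    then have "(\<lambda>n. (X (h n), Y (h n))) \<longlonglongrightarrow> (x, y)" by (intro tendsto_Pair h)
    then show ?thesis
      unfolding G_def closure_sequential by (intro exI[of _ y] exI[of _ "\<lambda>n. (X (h n), Y (h n))"]) auto
  qed
  have Guniq: "y = y'" if "(x, y) \<in> G" "(x, y') \<in> G" for x y y'
    using Gbound[OF complex_vector.subspace_diff[OF Gsub that]] by simp
  define L where "L x = (SOME y. (x, y) \<in> G)" for x
  have L: "(x, L x) \<in> G" if "x \<in> ?K" for x
    unfolding L_def using Gex[OF that] by (rule someI_ex)
  have Ksub: "csubspace ?K" by (intro csubspace_closure csubspace_range[OF X])
  have "G \<subseteq> UNIV \<times> closure (range Y)"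
    unfolding G_def using closure_subset[of "range Y"] by (intro closure_minimal closed_Times) auto
  then have LY: "L x \<in> closure (range Y)" if "x \<in> ?K" for x using L[OF that] by blast
  show ?thesis
  proof (rule that[of L])
    show "L \<in> bounded_ops ?K (closure (range Y))"
    proof (rule bounded_opsI[where C = 1])
      fix x y assume xy: "x \<in> ?K" "y \<in> ?K"
      have "(x + y, L x + L y) \<in> G"
        using complex_vector.subspace_add[OF Gsub L[OF xy(1)] L[OF xy(2)]] by simp
      then show "L (x + y) = L x + L y"
        using L[OF complex_vector.subspace_add[OF Ksub xy]] by (metis Guniq)
    next
      fix c x assume x: "x \<in> ?K"
      have "(scaleC c x, scaleC c (L x)) \<in> G"
        using complex_vector.subspace_scale[OF Gsub L[OF x]] by (simp add: scaleC_prod_def)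
      then show "L (scaleC c x) = scaleC c (L x)"
        using L[OF complex_vector.subspace_scale[OF Ksub x]] by (metis Guniq)
    qed (use LY Gbound[OF L] in auto)
    show "L (X h) = Y h" for h
    proof -
      have "(X h, Y h) \<in> range (\<lambda>h. (X h, Y h))" by blast
      then have "(X h, Y h) \<in> G" unfolding G_def by (rule subsetD[OF closure_subset])
      moreover have "X h \<in> ?K" by (rule subsetD[OF closure_subset]) blast
      ultimately show ?thesis using Guniq[OF L] by blast
    qed
  qed
qed

section \<open>Positive operators and square roots\<close>

lemma positive_op_bounded_ops: "positive_op A \<Longrightarrow> A \<in> bounded_ops UNIV UNIV"
  and positive_op_Re_nonneg: "positive_op A \<Longrightarrow> 0 \<le> Re (cinner (A x) x)"
  and positive_op_Im: "positive_op A \<Longrightarrow> Im (cinner (A x) x) = 0"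
  by (auto simp: positive_op_def)

text \<open>Polarization: reality of the quadratic form at \<open>x + y\<close> settles the
  imaginary parts, and at \<open>i x + y\<close> the real parts.\<close>

lemma positive_op_self_adjoint:
  assumes "positive_op A"
  shows "cinner (A x) y = cinner x (A y)"
proof -
  note A = positive_op_bounded_ops[OF assms]
  have Im: "Im (cinner (A u) v + cinner (A v) u) = 0" for u v
    using positive_op_Im[OF assms, of "u + v"] positive_op_Im[OF assms, of u] positive_op_Im[OF assms, of v]
    by (simp add: bounded_opsD(2)[OF A] cinner_add_left cinner_add_right)
  have "Im (cinner (A x) y) = - Im (cinner (A y) x)" using Im[of x y] by simp
  moreover have "Re (cinner (A x) y) = Re (cinner (A y) x)"
    using Im[of "scaleC \<i> x" y]
    by (simp add: bounded_opsD(3)[OF A] cinner_scaleC_left cinner_scaleC_right)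
  ultimately have "cinner (A x) y = cnj (cinner (A y) x)" by (simp add: complex_eq_iff)
  then show ?thesis by (subst (asm) cinner_commute[of x "A y", symmetric])
qed

lemma positive_opI:
  assumes A: "A \<in> bounded_ops UNIV UNIV"
    and sa: "\<And>x y. cinner (A x) y = cinner x (A y)"
    and nonneg: "\<And>x. 0 \<le> Re (cinner (A x) x)"
  shows "positive_op A"
proof -
  have "Im (cinner (A x) x) = 0" for x
    using sa[of x x] cinner_commute[of x "A x"] by (simp add: complex_eq_iff)
  then show ?thesis using A nonneg by (simp add: positive_op_def)
qed

text \<open>Expand \<open>0 \<le> \<langle>A (x - A x), x - A x\<rangle>\<close>.\<close>

lemma positive_contraction_norm_square_le:
  assumes A: "positive_op A" and le: "\<And>x. Re (cinner (A x) x) \<le> (norm x)\<^sup>2"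
  shows "(norm (A x))\<^sup>2 \<le> Re (cinner (A x) x)"
proof -
  let ?y = "A x"
  note lin = positive_op_bounded_ops[OF A]
  have "A (x - ?y) = ?y - A ?y"
    by (rule bounded_ops_diff[OF lin]) (auto simp: complex_vector.subspace_UNIV)
  then have "cinner (A (x - ?y)) (x - ?y) = cinner ?y x - cinner ?y ?y - cinner (A ?y) x + cinner (A ?y) ?y"
    by (simp add: cinner.diff_left cinner.diff_right)
  also have "cinner (A ?y) x = cinner ?y ?y" by (rule positive_op_self_adjoint[OF A])
  finally have "0 \<le> Re (cinner ?y x) - 2 * (norm ?y)\<^sup>2 + Re (cinner (A ?y) ?y)"
    using positive_op_Re_nonneg[OF A, of "x - ?y"] by (simp add: norm_square_eq_cinner)
  then show ?thesis using le[of ?y] by linarith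
qed

text \<open>The nonnegative form attains its minimum 0 at \<open>x\<close>, so its derivative in the
  direction \<open>- A x\<close>, which is \<open>-2 |A x|^2\<close>, cannot be negative.\<close>

lemma positive_op_eq_0:
  assumes A: "positive_op A" and 0: "Re (cinner (A x) x) = 0"
  shows "A x = 0"
proof -
  note lin = positive_op_bounded_ops[OF A]
  let ?y = "A x"
  obtain C where C: "0 \<le> C" "\<And>x. norm (A x) \<le> C * norm x"
    using bounded_ops_bound[OF lin] by auto
  have key: "2 * t * (norm ?y)\<^sup>2 \<le> t\<^sup>2 * Re (cinner (A ?y) ?y)" for t :: real
  proof -
    have eq: "A (x - t *\<^sub>R ?y) = ?y - t *\<^sub>R A ?y"
      by (simp add: bounded_ops_diff[OF lin] complex_vector.subspace_UNIV scaleR_scaleC bounded_opsD(3)[OF lin])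
    have "cinner (A (x - t *\<^sub>R ?y)) (x - t *\<^sub>R ?y) =
        cinner ?y x - t *\<^sub>R cinner ?y ?y - t *\<^sub>R cinner (A ?y) x + t *\<^sub>R t *\<^sub>R cinner (A ?y) ?y"
      unfolding eq
      by (simp add: cinner.diff_left cinner.diff_right cinner.scaleR_left cinner.scaleR_right algebra_simps)
    also have "cinner (A ?y) x = cinner ?y ?y" by (rule positive_op_self_adjoint[OF A])
    finally have "Re (cinner (A (x - t *\<^sub>R ?y)) (x - t *\<^sub>R ?y)) =
        - (2 * t * (norm ?y)\<^sup>2) + t\<^sup>2 * Re (cinner (A ?y) ?y)"
      using 0 unfolding norm_square_eq_cinner by (simp add: power2_eq_square)
    then show ?thesis using positive_op_Re_nonneg[OF A, of "x - t *\<^sub>R ?y"] by linarith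
  qed
  have "(norm ?y)\<^sup>2 = 0"
  proof (rule ccontr)
    assume ne: "(norm ?y)\<^sup>2 \<noteq> 0"
    define q where "q = Re (cinner (A ?y) ?y)"
    have q: "0 \<le> q" using positive_op_Re_nonneg[OF A] by (simp add: q_def)
    \<comment> \<open>Small enough that the quadratic term is at most half of the linear one; the
      summand 1 keeps the denominator positive when \<open>q = 0\<close>.\<close>
    define t where "t = (norm ?y)\<^sup>2 / (q + 1)"
    have t: "0 < t" using ne q by (simp add: t_def)
    have "2 * (norm ?y)\<^sup>2 \<le> t * q" using key[of t] t by (simp add: q_def power2_eq_square)
    also have "\<dots> \<le> (norm ?y)\<^sup>2" using q by (simp add: t_def field_simps)
    finally show False using ne by simp
  qed
  then show ?thesis by simp
qed

lemma cinner_square_root: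
  assumes "positive_op R" "R \<circ> R = A"
  shows "cinner (R x) (R y) = cinner (A x) y"
  using positive_op_self_adjoint[OF assms(1), of "R x" y] assms(2) by (auto simp: fun_eq_iff)

text \<open>For \<open>B = I - A\<close> the iterates of \<open>Y \<mapsto> (B + Y\<^sup>2) / 2\<close> converge to \<open>I - A\<^sup>1\<^sup>/\<^sup>2\<close>. Their increments are
  dominated by those of the scalar recursion for \<open>B = 1\<close>.\<close>

primrec sqrt_iter :: "('a :: complex_inner \<Rightarrow> 'a) \<Rightarrow> nat \<Rightarrow> 'a \<Rightarrow> 'a" where
  "sqrt_iter B 0 x = 0"
| "sqrt_iter B (Suc n) x = (1/2) *\<^sub>R (B x + sqrt_iter B n (sqrt_iter B n x))"

primrec sqrt_majorant :: "nat \<Rightarrow> real" where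
  "sqrt_majorant 0 = 0"
| "sqrt_majorant (Suc n) = (1 + (sqrt_majorant n)\<^sup>2) / 2"

lemma sqrt_majorant_bounds: "0 \<le> sqrt_majorant n" "sqrt_majorant n \<le> 1"
proof -
  have "0 \<le> sqrt_majorant n \<and> sqrt_majorant n \<le> 1"
    by (induction n) (auto simp: power_le_one)
  then show "0 \<le> sqrt_majorant n" "sqrt_majorant n \<le> 1" by auto
qed

lemma sqrt_majorant_mono: "sqrt_majorant n \<le> sqrt_majorant (Suc n)"
proof -
  have "2 * sqrt_majorant (Suc n) - 2 * sqrt_majorant n = (1 - sqrt_majorant n)\<^sup>2"
    by (simp add: power2_eq_square algebra_simps)
  then show ?thesis using zero_le_power2[of "1 - sqrt_majorant n"] by linarith
qed

context
  fixes B :: "'a :: chilbert_space \<Rightarrow> 'a"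
  assumes B: "B \<in> bounded_ops UNIV UNIV"
    and contr: "\<And>x. norm (B x) \<le> norm x"
begin

lemma sqrt_iter_bounded_ops: "sqrt_iter B n \<in> bounded_ops UNIV UNIV"
proof (induction n)
  case 0
  have "sqrt_iter B 0 = (\<lambda>x. 0)" by auto
  then show ?case by (simp add: bounded_ops_zero)
next
  case (Suc n)
  have "sqrt_iter B (Suc n) = (\<lambda>x. scaleC (1/2) (B x + (sqrt_iter B n \<circ> sqrt_iter B n) x))"
    by (auto simp: scaleR_scaleC)
  then show ?case
    using bounded_ops_scaleC[OF bounded_ops_add[OF B bounded_ops_comp[OF Suc Suc]]]
    by (simp add: complex_vector.subspace_UNIV)
qed

lemmas sqrt_iter_linear = bounded_linear.linear[OF bounded_ops_imp_bounded_linear[OF sqrt_iter_bounded_ops]]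

lemma sqrt_iter_commute:
  assumes C: "C \<in> bounded_ops UNIV UNIV" and comm: "\<And>x. C (B x) = B (C x)"
  shows "C (sqrt_iter B n x) = sqrt_iter B n (C x)"
proof (induction n arbitrary: x)
  case 0
  then show ?case using linear_0[OF bounded_linear.linear[OF bounded_ops_imp_bounded_linear[OF C]]] by simp
next
  case (Suc n)
  then show ?case
    by (simp add: linear_cmul[OF bounded_linear.linear[OF bounded_ops_imp_bounded_linear[OF C]]]
        linear_add[OF bounded_linear.linear[OF bounded_ops_imp_bounded_linear[OF C]]] comm)
qed

lemma sqrt_iter_commute_iter: "sqrt_iter B m (sqrt_iter B n x) = sqrt_iter B n (sqrt_iter B m x)"
proof (rule sqrt_iter_commute[OF sqrt_iter_bounded_ops])
  show "sqrt_iter B m (B x) = B (sqrt_iter B m x)" for x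
    by (rule sqrt_iter_commute[OF B, symmetric]) simp
qed

lemma norm_sqrt_iter_le: "norm (sqrt_iter B n x) \<le> sqrt_majorant n * norm x"
proof (induction n arbitrary: x)
  case (Suc n)
  have "norm (sqrt_iter B n (sqrt_iter B n x)) \<le> sqrt_majorant n * (sqrt_majorant n * norm x)"
    using Suc[of "sqrt_iter B n x"] mult_left_mono[OF Suc[of x] sqrt_majorant_bounds(1)[of n]] by (rule order_trans)
  from norm_triangle_mono[OF contr this]
  have "norm (B x + sqrt_iter B n (sqrt_iter B n x)) / 2 \<le> (norm x + sqrt_majorant n * (sqrt_majorant n * norm x)) / 2"
    by simp
  then show ?case by (simp add: power2_eq_square algebra_simps del: scaleR_add_right)
qed simp

lemma norm_sqrt_iter_le_norm: "norm (sqrt_iter B n x) \<le> norm x"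
  using norm_sqrt_iter_le[of n x] mult_right_mono[OF sqrt_majorant_bounds(2)[of n] norm_ge_zero[of x]] by simp

lemma norm_sqrt_iter_Suc_diff_le:
  "norm (sqrt_iter B (Suc n) x - sqrt_iter B n x) \<le> (sqrt_majorant (Suc n) - sqrt_majorant n) * norm x"
proof (induction n arbitrary: x)
  case 0
  then show ?case using contr[of x] by simp
next
  case (Suc n)
  define Y Z where "Y = sqrt_iter B n" and "Z = sqrt_iter B (Suc n)"
  define s t where "s = sqrt_majorant n" and "t = sqrt_majorant (Suc n)"
  have YZ: "Y (Z u) = Z (Y u)" for u unfolding Y_def Z_def by (rule sqrt_iter_commute_iter)
  have lin: "linear Y" "linear Z" unfolding Y_def Z_def by (rule sqrt_iter_linear)+
  have "sqrt_iter B (Suc (Suc n)) x - Z x = (1/2) *\<^sub>R (Z (Z x) - Y (Y x))"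
    by (simp add: Y_def Z_def scaleR_diff_right[symmetric])
  \<comment> \<open>The iterates commute, so \<open>Z^2 - Y^2 = (Z - Y)(Z + Y)\<close> and the
    induction hypothesis applies at \<open>Z x + Y x\<close>. The majorant obeys the same
    factorization, which is why it bounds the increments exactly.\<close>
  also have "Z (Z x) - Y (Y x) = Z (Z x + Y x) - Y (Z x + Y x)"
    by (simp add: linear_add lin YZ)
  finally have "norm (sqrt_iter B (Suc (Suc n)) x - Z x) = norm (Z (Z x + Y x) - Y (Z x + Y x)) / 2"
    by simp
  also have "\<dots> \<le> (t - s) * norm (Z x + Y x) / 2"
    using Suc[of "Z x + Y x"] by (simp add: Y_def Z_def s_def t_def del: sqrt_iter.simps sqrt_majorant.simps)
  also have "\<dots> \<le> (t - s) * ((t + s) * norm x) / 2"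
  proof -
    have "norm (Z x + Y x) \<le> (t + s) * norm x"
      using norm_triangle_ineq[of "Z x" "Y x"] norm_sqrt_iter_le[of n x] norm_sqrt_iter_le[of "Suc n" x]
      by (simp add: Y_def Z_def s_def t_def distrib_right del: sqrt_iter.simps sqrt_majorant.simps)
    then show ?thesis
      using sqrt_majorant_mono[of n] by (simp add: s_def t_def mult_left_mono del: sqrt_majorant.simps)
  qed
  also have "\<dots> = (sqrt_majorant (Suc (Suc n)) - sqrt_majorant (Suc n)) * norm x"
  proof -
    have "sqrt_majorant (Suc (Suc n)) = (1 + t\<^sup>2) / 2" "sqrt_majorant (Suc n) = (1 + s\<^sup>2) / 2"
      by (simp_all add: s_def t_def)
    moreover have "(t - s) * ((t + s) * norm x) / 2 = ((1 + t\<^sup>2) / 2 - (1 + s\<^sup>2) / 2) * norm x"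
      by (simp add: power2_eq_square field_simps)
    ultimately show ?thesis by simp
  qed
  finally show ?case by (simp add: Z_def)
qed

definition sqrt_limit :: "'a \<Rightarrow> 'a" where
  "sqrt_limit x = lim (\<lambda>n. sqrt_iter B n x)"

lemma sqrt_iter_tendsto: "(\<lambda>n. sqrt_iter B n x) \<longlonglongrightarrow> sqrt_limit x"
proof -
  have "incseq sqrt_majorant" using sqrt_majorant_mono by (rule incseq_SucI)
  then have "convergent sqrt_majorant"
    using sqrt_majorant_bounds by (metis incseq_convergent convergent_def)
  then have "summable (\<lambda>n. sqrt_majorant (Suc n) - sqrt_majorant n)"
    unfolding convergent_def using telescope_summable by blast
  then have "summable (\<lambda>n. (sqrt_majorant (Suc n) - sqrt_majorant n) * norm x)"
    by (rule summable_mult2)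
  then have "summable (\<lambda>n. sqrt_iter B (Suc n) x - sqrt_iter B n x)"
    by (rule summable_comparison_test'[where N = 0]) (rule norm_sqrt_iter_Suc_diff_le)
  then have "convergent (\<lambda>n. \<Sum>k<n. sqrt_iter B (Suc k) x - sqrt_iter B k x)"
    by (simp only: summable_iff_convergent)
  then have "convergent (\<lambda>n. sqrt_iter B n x)"
    by (simp only: sum_lessThan_telescope[of "\<lambda>n. sqrt_iter B n x"] sqrt_iter.simps(1) diff_zero)
  then show ?thesis unfolding sqrt_limit_def by (simp add: convergent_LIMSEQ_iff)
qed

lemma norm_sqrt_limit_le: "norm (sqrt_limit x) \<le> norm x"
  by (rule LIMSEQ_le_const2[OF tendsto_norm[OF sqrt_iter_tendsto]]) (auto intro: norm_sqrt_iter_le_norm)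

lemma sqrt_limit_bounded_ops: "sqrt_limit \<in> bounded_ops UNIV UNIV"
proof (rule bounded_opsI[where C = 1])
  show "sqrt_limit (x + y) = sqrt_limit x + sqrt_limit y" for x y
    using sqrt_iter_tendsto[of "x + y"] tendsto_add[OF sqrt_iter_tendsto[of x] sqrt_iter_tendsto[of y]]
    by (simp add: linear_add[OF sqrt_iter_linear] LIMSEQ_unique)
  show "sqrt_limit (scaleC c x) = scaleC c (sqrt_limit x)" for c x
    using sqrt_iter_tendsto[of "scaleC c x"]
      bounded_linear.tendsto[OF bounded_linear_scaleC sqrt_iter_tendsto[of x], of c]
    by (simp add: bounded_opsD(3)[OF sqrt_iter_bounded_ops] LIMSEQ_unique)
qed (simp_all add: norm_sqrt_limit_le)

lemma sqrt_limit_fixpoint: "sqrt_limit x = (1/2) *\<^sub>R (B x + sqrt_limit (sqrt_limit x))"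
proof -
  \<comment> \<open>In \<open>Y_n (Y_n x)\<close> both the operator and its argument vary with
    \<open>n\<close>; since all iterates are contractions, the moving argument may be replaced by
    its limit.\<close>
  have "(\<lambda>n. sqrt_iter B n (sqrt_iter B n x - sqrt_limit x)) \<longlonglongrightarrow> 0"
  proof (rule Lim_null_comparison)
    show "(\<lambda>n. norm (sqrt_iter B n x - sqrt_limit x)) \<longlonglongrightarrow> 0"
      using tendsto_norm_zero[OF LIM_zero[OF sqrt_iter_tendsto]] .
  qed (simp add: norm_sqrt_iter_le_norm)
  from tendsto_add[OF this sqrt_iter_tendsto[of "sqrt_limit x"]]
  have "(\<lambda>n. sqrt_iter B n (sqrt_iter B n x)) \<longlonglongrightarrow> sqrt_limit (sqrt_limit x)"
    by (simp add: linear_diff[OF sqrt_iter_linear])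
  then have "(\<lambda>n. sqrt_iter B (Suc n) x) \<longlonglongrightarrow> (1/2) *\<^sub>R (B x + sqrt_limit (sqrt_limit x))"
    unfolding sqrt_iter.simps by (intro tendsto_intros)
  then show ?thesis using LIMSEQ_Suc[OF sqrt_iter_tendsto[of x]] LIMSEQ_unique by blast
qed

lemma sqrt_limit_commute:
  assumes C: "C \<in> bounded_ops UNIV UNIV" and comm: "\<And>x. C (B x) = B (C x)"
  shows "C (sqrt_limit x) = sqrt_limit (C x)"
  using bounded_linear.tendsto[OF bounded_ops_imp_bounded_linear[OF C] sqrt_iter_tendsto[of x]]
    sqrt_iter_tendsto[of "C x"]
  by (simp add: sqrt_iter_commute[OF C comm] LIMSEQ_unique)

lemma sqrt_limit_self_adjoint:
  assumes sa: "\<And>x y. cinner (B x) y = cinner x (B y)"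
  shows "cinner (sqrt_limit x) y = cinner x (sqrt_limit y)"
proof -
  have "cinner (sqrt_iter B n x) y = cinner x (sqrt_iter B n y)" for n x y
    by (induction n arbitrary: x y)
       (simp_all add: cinner.zero_left cinner.zero_right cinner.scaleR_left cinner.scaleR_right
          cinner_add_left cinner_add_right sa)
  then show ?thesis
    using cinner.tendsto[OF sqrt_iter_tendsto[of x] tendsto_const[of y]]
      cinner.tendsto[OF tendsto_const[of x] sqrt_iter_tendsto[of y]]
    by (simp add: LIMSEQ_unique)
qed

end

text \<open>The commutation clause serves uniqueness: any other positive root of \<open>A\<close>
  commutes with \<open>A\<close>, hence with this \<open>S\<close>. It holds because
  \<open>S\<close> is a limit of polynomials in \<open>A\<close>.\<close>

lemma positive_sqrt_exists:
  fixes A :: "'a :: chilbert_space \<Rightarrow> 'a"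
  assumes A: "positive_op A" and le: "\<And>x. Re (cinner (A x) x) \<le> (norm x)\<^sup>2"
  obtains S where "positive_op S" "S \<circ> S = A"
    "\<And>C x. C \<in> bounded_ops UNIV UNIV \<Longrightarrow> (\<And>x. C (A x) = A (C x)) \<Longrightarrow> C (S x) = S (C x)"
proof -
  note Ab = positive_op_bounded_ops[OF A]
  have neg: "(\<lambda>x. x - C x) \<in> bounded_ops UNIV UNIV" if "C \<in> bounded_ops UNIV UNIV" for C :: "'a \<Rightarrow> 'a"
  proof -
    have "(\<lambda>x. x - C x) = (\<lambda>x. id x + scaleC (-1) (C x))"
      by (auto simp: complex_vector.scale_minus_left scaleC_one)
    then show ?thesis
      by (simp only:) (intro bounded_ops_add bounded_ops_scaleC bounded_ops_id that complex_vector.subspace_UNIV)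
  qed
  define B where "B x = x - A x" for x
  have Bb: "B \<in> bounded_ops UNIV UNIV" using neg[OF Ab] by (simp add: B_def[abs_def])
  have Bsa: "cinner (B x) y = cinner x (B y)" for x y
    by (simp add: B_def cinner.diff_left cinner.diff_right positive_op_self_adjoint[OF A])
  have BRe: "Re (cinner (B x) x) = (norm x)\<^sup>2 - Re (cinner (A x) x)" for x
    by (simp add: B_def cinner.diff_left norm_square_eq_cinner)
  have Bpos: "positive_op B" using le by (intro positive_opI Bb Bsa) (simp add: BRe)
  have contr: "norm (B x) \<le> norm x" for x
  proof (rule power2_le_imp_le)
    have "(norm (B x))\<^sup>2 \<le> Re (cinner (B x) x)"
      by (rule positive_contraction_norm_square_le[OF Bpos]) (simp add: BRe positive_op_Re_nonneg[OF A])
    also have "\<dots> \<le> (norm x)\<^sup>2" by (simp add: BRe positive_op_Re_nonneg[OF A])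
    finally show "(norm (B x))\<^sup>2 \<le> (norm x)\<^sup>2" .
  qed simp
  define Y where "Y = sqrt_limit B"
  note Yb = sqrt_limit_bounded_ops[OF Bb contr, folded Y_def]
  show ?thesis
  proof (rule that[of "\<lambda>x. x - Y x"])
    show "positive_op (\<lambda>x. x - Y x)"
    proof (rule positive_opI[OF neg[OF Yb]])
      show "cinner (x - Y x) y = cinner x (y - Y y)" for x y
        using sqrt_limit_self_adjoint[OF Bb contr Bsa, of x y]
        by (simp add: Y_def cinner.diff_left cinner.diff_right)
      show "0 \<le> Re (cinner (x - Y x) x)" for x
      proof -
        have "Re (cinner (Y x) x) \<le> norm (Y x) * norm x"
          using complex_Re_le_cmod cmod_cinner_le_norm_mult by (rule order_trans)
        also have "\<dots> \<le> norm x * norm x"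
          unfolding Y_def using norm_sqrt_limit_le[OF Bb contr, of x] by (rule mult_right_mono) simp
        finally show ?thesis by (simp add: cinner.diff_left norm_square_eq_cinner[symmetric] power2_eq_square)
      qed
    qed
    show "(\<lambda>x. x - Y x) \<circ> (\<lambda>x. x - Y x) = A"
    proof
      fix x
      have "2 *\<^sub>R Y x = B x + Y (Y x)"
        using sqrt_limit_fixpoint[OF Bb contr, of x, folded Y_def] by (metis scaleR_half_double scaleR_2 scaleR_right_distrib)
      then have "Y (Y x) = Y x + Y x - B x" by (simp add: scaleR_2)
      then show "((\<lambda>x. x - Y x) \<circ> (\<lambda>x. x - Y x)) x = A x"
        by (simp add: bounded_ops_diff[OF Yb] complex_vector.subspace_UNIV B_def)
    qed
    fix C :: "'a \<Rightarrow> 'a" and x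
    assume C: "C \<in> bounded_ops UNIV UNIV" and comm: "\<And>x. C (A x) = A (C x)"
    have "C (B x) = B (C x)" for x
      by (simp add: B_def bounded_ops_diff[OF C] complex_vector.subspace_UNIV comm)
    then show "C (x - Y x) = C x - Y (C x)"
      using sqrt_limit_commute[OF Bb contr C]
      by (simp add: Y_def bounded_ops_diff[OF C] complex_vector.subspace_UNIV)
  qed
qed

text \<open>For \<open>y = (S - R) x\<close> commutation gives
  \<open>(S + R) y = (S^2 - R^2) x = 0\<close>. Both nonnegative forms then vanish at
  \<open>y\<close>, so \<open>S y = R y = 0\<close> and
  \<open>|y|^2 = cinner x ((S - R) y) = 0\<close>.\<close>

lemma positive_sqrt_unique:
  fixes R S :: "'a :: chilbert_space \<Rightarrow> 'a"
  assumes R: "positive_op R" and S: "positive_op S"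
    and eq: "R \<circ> R = S \<circ> S" and comm: "\<And>x. R (S x) = S (R x)"
  shows "R = S"
proof
  fix x
  have sq: "R (R u) = S (S u)" for u using eq by (auto simp: fun_eq_iff)
  note Rd = bounded_ops_diff[OF positive_op_bounded_ops[OF R] complex_vector.subspace_UNIV]
    and Sd = bounded_ops_diff[OF positive_op_bounded_ops[OF S] complex_vector.subspace_UNIV]
  define y where "y = S x - R x"
  have "S y + R y = 0" by (simp add: y_def Rd Sd sq comm)
  then have "Re (cinner (S y) y) + Re (cinner (R y) y) = 0"
    by (metis cinner.add_left cinner.zero_left plus_complex.sel(1) zero_complex.sel(1))
  then have "Re (cinner (S y) y) = 0" "Re (cinner (R y) y) = 0"
    using positive_op_Re_nonneg[OF R, of y] positive_op_Re_nonneg[OF S, of y] by linarith+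
  then have "S y = 0" "R y = 0" by (auto intro: positive_op_eq_0 R S)
  moreover have "cinner (S x - R x) y = cinner x (S y - R y)"
    by (simp add: cinner.diff_left cinner.diff_right positive_op_self_adjoint R S)
  ultimately have "cinner y y = 0" by (simp add: y_def cinner.zero_right)
  then show "R x = S x" by (simp add: y_def)
qed

text \<open>\<open>sqrt_op\<close> is a definite description, so nothing is known about it before
  existence and uniqueness are combined. Later arguments use the root only through its positivity
  and these inner products.\<close>

lemma
  fixes A :: "'a :: chilbert_space \<Rightarrow> 'a"
  assumes A: "positive_op A" and le: "\<And>x. Re (cinner (A x) x) \<le> (norm x)\<^sup>2"
  shows positive_sqrt_op: "positive_op (sqrt_op A)"
    and cinner_sqrt_op: "cinner (sqrt_op A x) (sqrt_op A y) = cinner (A x) y"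
proof -
  obtain S where S: "positive_op S" "S \<circ> S = A"
    and comm: "\<And>C x. C \<in> bounded_ops UNIV UNIV \<Longrightarrow> (\<And>x. C (A x) = A (C x)) \<Longrightarrow> C (S x) = S (C x)"
    using positive_sqrt_exists[OF A le] by metis
  have uniq: "R = S" if R: "positive_op R" "R \<circ> R = A" for R
  proof (rule positive_sqrt_unique[OF R(1) S(1)])
    have RR: "R (R u) = A u" for u using fun_cong[OF R(2), of u] by simp
    have "R (A u) = A (R u)" for u by (simp only: RR[symmetric])
    then show "R (S x) = S (R x)" for x by (rule comm[OF positive_op_bounded_ops[OF R(1)]])
  qed (simp add: R S)
  have "sqrt_op A = S"
    unfolding sqrt_op_def
  proof (rule the_equality)
    show "positive_op S \<and> S \<circ> S = A" using S by (rule conjI)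
    show "R = S" if "positive_op R \<and> R \<circ> R = A" for R
      using that by (elim conjE) (rule uniq)
  qed
  then show "positive_op (sqrt_op A)" "cinner (sqrt_op A x) (sqrt_op A y) = cinner (A x) y"
    by (simp_all only: S(1) cinner_square_root[OF S])
qed

section \<open>Square-summable families over words\<close>

lemma ell2_eqI: "(\<And>i. ell2_nth x i = ell2_nth y i) \<Longrightarrow> x = y"
  by (auto simp: ell2_nth_inject[symmetric])

lemma ell2_nth_bounded_ops: "(\<lambda>x. ell2_nth x i) \<in> bounded_ops UNIV UNIV"
  by (rule bounded_opsI[where C = 1]) (simp_all add: plus_ell2.rep_eq scaleC_ell2.rep_eq norm_nth_le_ell2)

lemma ell2_nth_sum: "ell2_nth (\<Sum>i\<in>I. x i) w = (\<Sum>i\<in>I. ell2_nth (x i) w)"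
  by (rule linear_sum[OF bounded_linear.linear[OF bounded_ops_imp_bounded_linear[OF ell2_nth_bounded_ops]]])

lift_definition ell2_single :: "'i \<Rightarrow> 'h :: complex_inner \<Rightarrow> ('i, 'h) ell2"
  is "\<lambda>i h j. if j = i then h else 0"
proof -
  fix i :: 'i and h :: 'h
  have "(\<lambda>j. (norm (if j = i then h else 0))\<^sup>2) summable_on {i}" by simp
  then show "(\<lambda>j. (norm (if j = i then h else 0))\<^sup>2) summable_on UNIV"
    by (rule summable_on_cong_neutral[THEN iffD1, rotated -1]) auto
qed

lemma cinner_ell2_single: "cinner (ell2_single i h) x = cinner h (ell2_nth x i)"
proof -
  have "(\<Sum>\<^sub>\<infinity>j. cinner (ell2_nth (ell2_single i h) j) (ell2_nth x j)) = (\<Sum>\<^sub>\<infinity>j\<in>{i}. cinner h (ell2_nth x j))"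
    by (rule infsum_cong_neutral) (auto simp: ell2_single.rep_eq cinner.zero_left)
  then show ?thesis by (simp add: cinner_ell2_def)
qed

lemma norm_ell2_single [simp]: "norm (ell2_single i h) = norm h"
  by (simp add: norm_eq_sqrt_cinner cinner_ell2_single ell2_single.rep_eq)

lemma ell2_single_bounded_ops: "ell2_single i \<in> bounded_ops UNIV UNIV"
  by (rule bounded_opsI[where C = 1])
     (auto intro!: ell2_eqI simp: plus_ell2.rep_eq scaleC_ell2.rep_eq ell2_single.rep_eq
        complex_vector.scale_zero_right)

text \<open>The operator \<open>I \<otimes> d\<^sup>*\<close> from \<open>\<ell>\<^sup>2(I; H)\<close> to \<open>\<ell>\<^sup>2(I)\<close>.\<close>

lift_definition slice :: "'h :: complex_inner \<Rightarrow> ('i, 'h) ell2 \<Rightarrow> ('i, complex) ell2"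
  is "\<lambda>d x i. cinner (x i) d"
proof -
  fix d :: 'h and x :: "'i \<Rightarrow> 'h"
  assume x: "(\<lambda>i. (norm (x i))\<^sup>2) summable_on UNIV"
  show "(\<lambda>i. (norm (cinner (x i) d))\<^sup>2) summable_on UNIV"
  proof (rule summable_on_comparison_test)
    show "(\<lambda>i. (norm (x i))\<^sup>2 * (norm d)\<^sup>2) summable_on UNIV"
      by (intro summable_on_cmult_left x)
    show "(norm (cinner (x i) d))\<^sup>2 \<le> (norm (x i))\<^sup>2 * (norm d)\<^sup>2" for i
      using power_mono[OF cmod_cinner_le_norm_mult[of "x i" d] norm_ge_zero, of 2] by (simp add: power_mult_distrib)
  qed simp
qed

lemma cinner_tensor_vec_left: "cinner (tensor_vec f d) x = cinner f (slice d x)"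
  unfolding cinner_ell2_def
  by (rule infsum_cong)
     (simp add: tensor_vec.rep_eq slice.rep_eq cinner_scaleC_left cinner_complex_def cinner_commute[symmetric])

lemma slice_bounded_ops:
  "(slice d :: ('i, 'h :: complex_inner) ell2 \<Rightarrow> ('i, complex) ell2) \<in> bounded_ops UNIV UNIV"
proof (rule bounded_opsI[where C = "norm d"])
  show "norm (slice d x) \<le> norm d * norm x" for x :: "('i, 'h) ell2"
  proof (rule norm_ell2_leI)
    fix F :: "'i set" assume F: "finite F"
    have "(\<Sum>i\<in>F. (norm (ell2_nth (slice d x) i))\<^sup>2) \<le> (\<Sum>i\<in>F. (norm d)\<^sup>2 * (norm (ell2_nth x i))\<^sup>2)"
      using power_mono[OF cmod_cinner_le_norm_mult[of "ell2_nth x _" d] norm_ge_zero, of _ 2]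
      by (intro sum_mono) (simp add: slice.rep_eq power_mult_distrib mult.commute)
    also have "\<dots> = (norm d)\<^sup>2 * (\<Sum>i\<in>F. (norm (ell2_nth x i))\<^sup>2)" by (simp add: sum_distrib_left)
    also have "\<dots> \<le> (norm d)\<^sup>2 * (norm x)\<^sup>2"
      by (intro mult_left_mono finite_sum_le_norm_ell2 F) simp
    finally show "(\<Sum>i\<in>F. (norm (ell2_nth (slice d x) i))\<^sup>2) \<le> (norm d * norm x)\<^sup>2"
      by (simp add: power_mult_distrib)
  qed simp
qed (auto intro!: ell2_eqI simp: slice.rep_eq plus_ell2.rep_eq scaleC_ell2.rep_eq
    cinner_add_left cinner_scaleC_left scaleC_complex_def)

section \<open>Hilbert tensor products inside square-summable families\<close>

lemma csubspace_hilbert_tensor: "csubspace (hilbert_tensor M D)"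
  unfolding hilbert_tensor_def by (intro csubspace_closure complex_vector.subspace_span)

lemma closed_hilbert_tensor: "closed (hilbert_tensor M D)"
  unfolding hilbert_tensor_def by simp

lemma tensor_vec_in_hilbert_tensor: "f \<in> M \<Longrightarrow> d \<in> D \<Longrightarrow> tensor_vec f d \<in> hilbert_tensor M D"
  unfolding hilbert_tensor_def
  by (intro subsetD[OF closure_subset] complex_vector.span_base) blast

lemma hilbert_tensor_subset:
  assumes "csubspace E" "closed E" "\<And>f d. f \<in> M \<Longrightarrow> d \<in> D \<Longrightarrow> tensor_vec f d \<in> E"
  shows "hilbert_tensor M D \<subseteq> E"
  unfolding hilbert_tensor_def using assms by (intro closure_cspan_subset) auto

lemma csubspace_vimage:
  assumes "A \<in> bounded_ops UNIV UNIV" "csubspace M"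
  shows "csubspace (A -` M)"
  using assms linear_0[OF bounded_linear.linear[OF bounded_ops_imp_bounded_linear[OF assms(1)]]]
  by (intro complex_vector.subspaceI)
     (auto simp: bounded_opsD[OF assms(1)] intro: complex_vector.subspace_0
        complex_vector.subspace_add complex_vector.subspace_scale)

lemma closed_vimage_bounded_ops:
  "A \<in> bounded_ops UNIV UNIV \<Longrightarrow> closed M \<Longrightarrow> closed (A -` M)"
  by (intro continuous_closed_vimage linear_continuous_at bounded_ops_imp_bounded_linear)

text \<open>Membership is tested by slices on one side and by coordinates on the other, without a
  basis of \<open>N\<close> or \<open>D\<close>. Both conditions define a closed subspace
  \<open>G\<close> containing the tensor product, and the residual of the projection of
  \<open>x\<close> onto the tensor product stays in \<open>G\<close>, where it is shown to
  vanish.\<close>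

lemma hilbert_tensor_memI:
  fixes x :: "('i, 'h :: chilbert_space) ell2"
  assumes N: "csubspace N" "closed N" and D: "csubspace D" "closed D"
    and slice: "\<And>d. d \<in> D \<Longrightarrow> slice d x \<in> N" and nth: "\<And>i. ell2_nth x i \<in> D"
  shows "x \<in> hilbert_tensor N D"
proof -
  let ?E = "hilbert_tensor N D"
  note E = csubspace_hilbert_tensor[of N D] closed_hilbert_tensor[of N D]
  define G where "G = (\<Inter>d\<in>D. slice d -` N) \<inter> (\<Inter>i. (\<lambda>x. ell2_nth x i) -` D)"
  have Gsub: "csubspace G"
    unfolding G_def
    by (intro complex_vector.subspace_inter complex_vector.subspace_Inter ballI)
       (auto intro!: csubspace_vimage slice_bounded_ops ell2_nth_bounded_ops N D)
  have "closed G"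
    unfolding G_def
    by (intro closed_Int closed_INT ballI closed_vimage_bounded_ops slice_bounded_ops ell2_nth_bounded_ops N D)
  moreover have "tensor_vec f d \<in> G" if "f \<in> N" "d \<in> D" for f d
  proof -
    have "slice d' (tensor_vec f d) = scaleC (cinner d d') f" for d'
      by (rule ell2_eqI)
         (simp add: slice.rep_eq tensor_vec.rep_eq scaleC_ell2.rep_eq scaleC_complex_def cinner_scaleC_left)
    then show ?thesis
      using that N D by (auto simp: G_def tensor_vec.rep_eq complex_vector.subspace_scale)
  qed
  ultimately have EG: "?E \<subseteq> G" using Gsub by (intro hilbert_tensor_subset) auto
  define g where "g = x - orth_proj ?E x"
  have "x \<in> G" using slice nth by (auto simp: G_def)
  then have g: "g \<in> G"
    unfolding g_def using EG orth_proj_in[OF E] by (intro complex_vector.subspace_diff Gsub) auto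
  have "ell2_nth g i = 0" for i
  proof -
    let ?d = "ell2_nth g i"
    have d: "?d \<in> D" and s: "slice ?d g \<in> N" using g by (auto simp: G_def)
    \<comment> \<open>The residual is paired with an elementary tensor made from itself, which is
      admissible because \<open>g\<close> lies in \<open>G\<close>. The pairing equals the squared
      norm of \<open>slice ?d g\<close>, whose coordinate at \<open>i\<close> is
      \<open>|?d|^2\<close>.\<close>
    have "cinner g (tensor_vec (slice ?d g) ?d) = 0"
      using orth_proj_residual[OF E, of x] tensor_vec_in_hilbert_tensor[OF s d]
      by (simp add: g_def orth_complement_def)
    then have "cinner (slice ?d g) (slice ?d g) = 0"
      unfolding cinner_tensor_vec_left[symmetric] by (subst cinner_commute) simp
    then have "ell2_nth (slice ?d g) i = 0" by (simp add: zero_ell2.rep_eq)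
    then show ?thesis by (simp add: slice.rep_eq)
  qed
  then have "g = 0" by (intro ell2_eqI) (simp add: zero_ell2.rep_eq)
  then show ?thesis using orth_proj_in[OF E, of x] by (simp add: g_def)
qed

text \<open>One family of shifts serves every coefficient space: for complex coefficients it is
  \<open>creation i\<close>, for coefficients in \<open>H\<close> it is \<open>creation i\<close>
  tensored with the identity.\<close>

lift_definition left_shift :: "'n \<Rightarrow> ('n list, 'h :: complex_inner) ell2 \<Rightarrow> ('n list, 'h) ell2"
  is "\<lambda>i x w. case w of [] \<Rightarrow> 0 | j # v \<Rightarrow> if j = i then x v else 0"
proof -
  fix i :: 'n and x :: "'n list \<Rightarrow> 'h"
  assume x: "(\<lambda>w. (norm (x w))\<^sup>2) summable_on UNIV"
  let ?f = "\<lambda>w. (norm (case w of [] \<Rightarrow> 0 | j # v \<Rightarrow> if j = i then x v else 0))\<^sup>2"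
  have "?f summable_on range ((#) i)" by (subst summable_on_reindex) (auto simp: o_def x)
  then show "?f summable_on UNIV"
    by (rule summable_on_cong_neutral[THEN iffD1, rotated -1]) (auto split: list.splits if_splits)
qed

lift_definition left_shift_adj :: "'n \<Rightarrow> ('n list, 'h :: complex_inner) ell2 \<Rightarrow> ('n list, 'h) ell2"
  is "\<lambda>i x w. x (i # w)"
proof -
  fix i :: 'n and x :: "'n list \<Rightarrow> 'h"
  assume "(\<lambda>w. (norm (x w))\<^sup>2) summable_on UNIV"
  then have "(\<lambda>w. (norm (x w))\<^sup>2) summable_on range ((#) i)" by (rule summable_on_subset_banach) simp
  then show "(\<lambda>w. (norm (x (i # w)))\<^sup>2) summable_on UNIV"
    by (subst (asm) summable_on_reindex) (auto simp: o_def)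
qed

lemma cinner_left_shift: "cinner (left_shift i x) y = cinner x (left_shift_adj i y)"
proof -
  let ?f = "\<lambda>w. cinner (ell2_nth (left_shift i x) w) (ell2_nth y w)"
  have "(\<Sum>\<^sub>\<infinity>w. ?f w) = (\<Sum>\<^sub>\<infinity>w\<in>range ((#) i). ?f w)"
    by (rule infsum_cong_neutral)
       (auto simp: left_shift.rep_eq cinner.zero_left split: list.splits if_splits)
  also have "\<dots> = (\<Sum>\<^sub>\<infinity>w. ?f (i # w))" by (subst infsum_reindex) (auto simp: o_def)
  finally show ?thesis by (simp add: cinner_ell2_def left_shift.rep_eq left_shift_adj.rep_eq)
qed

lemma norm_left_shift: "norm (left_shift i x) = norm x"
proof -
  have "left_shift_adj i (left_shift i x) = x"
    by (rule ell2_eqI) (simp add: left_shift.rep_eq left_shift_adj.rep_eq)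
  then show ?thesis by (simp add: norm_eq_sqrt_cinner cinner_left_shift)
qed

lemma left_shift_bounded_ops: "left_shift i \<in> bounded_ops UNIV UNIV"
  by (rule bounded_opsI[where C = 1])
     (auto intro!: ell2_eqI simp: norm_left_shift left_shift.rep_eq plus_ell2.rep_eq scaleC_ell2.rep_eq
        complex_vector.scale_zero_right split: list.splits)

lemma creation_eq_left_shift: "creation i = left_shift i"
  by (rule ext, rule ell2_eqI)
     (auto simp: creation_def fock_tensor.rep_eq left_shift.rep_eq axis_def split: list.splits)

lemma left_shift_tensor_vec: "left_shift i (tensor_vec f d) = tensor_vec (creation i f) d"
  by (rule ell2_eqI)
     (auto simp: creation_eq_left_shift left_shift.rep_eq tensor_vec.rep_eq split: list.splits)

lemma left_shift_adj_slice: "left_shift_adj i (slice d x) = slice d (left_shift_adj i x)"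
  by (rule ell2_eqI) (simp add: left_shift_adj.rep_eq slice.rep_eq)

text \<open>A word is empty or has a first letter: the identity is the vacuum projection plus the
  sum of the \<open>S_i S_i^*\<close>, tensored with the identity. For \<open>x = W h\<close> this
  becomes a recursion.\<close>

lemma cinner_ell2_words:
  fixes x y :: "('n :: finite list, 'h :: complex_inner) ell2"
  shows "cinner x y = cinner (ell2_nth x []) (ell2_nth y [])
    + (\<Sum>i\<in>UNIV. cinner (left_shift_adj i x) (left_shift_adj i y))"
proof -
  have "x = ell2_single [] (ell2_nth x []) + (\<Sum>i\<in>UNIV. left_shift i (left_shift_adj i x))"
  proof (rule ell2_eqI)
    show "ell2_nth x w = ell2_nth (ell2_single [] (ell2_nth x [])
        + (\<Sum>i\<in>UNIV. left_shift i (left_shift_adj i x))) w" for w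
      by (cases w) (simp_all add: plus_ell2.rep_eq ell2_nth_sum ell2_single.rep_eq left_shift.rep_eq
          left_shift_adj.rep_eq)
  qed
  then have "cinner x y = cinner (ell2_single [] (ell2_nth x [])
      + (\<Sum>i\<in>UNIV. left_shift i (left_shift_adj i x))) y" by simp
  then show ?thesis
    by (simp only: cinner_add_left cinner.sum_left cinner_ell2_single cinner_left_shift)
qed

section \<open>Ideals of the noncommutative analytic Toeplitz algebra\<close>

text \<open>Invariance of a subspace and orthogonality of a range are both conditions of this kind,
  for suitable sets \<open>R\<close> of pairs.\<close>

lemma closedin_wot_orthogonal:
  "closedin wot {A \<in> bounded_ops UNIV UNIV. \<forall>(x, y)\<in>R. cinner (A x) y = 0}"
proof -
  let ?S = "bounded_ops UNIV UNIV :: ('a \<Rightarrow> 'a) set"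
  let ?f = "\<lambda>A (x :: 'a, y). cinner (A x) y"
  let ?C = "{g :: 'a \<times> 'a \<Rightarrow> complex. \<forall>p\<in>R. g p = 0}"
  have "closed {g :: 'a \<times> 'a \<Rightarrow> complex. g p = 0}" for p
    by (intro closed_Collect_eq continuous_on_product_coordinates continuous_on_const)
  moreover have "?C = (\<Inter>p\<in>R. {g. g p = 0})" by auto
  ultimately have "open (- ?C)" by (auto intro: closed_INT simp: open_closed)
  then have "openin wot (?f -` (- ?C) \<inter> ?S)"
    unfolding wot_def openin_pullback_topology by (auto simp: open_openin[symmetric])
  moreover have "topspace (wot :: ('a \<Rightarrow> 'a) topology) = ?S"
    unfolding wot_def by (simp add: topspace_pullback_topology)
  moreover have "?S - {A \<in> ?S. \<forall>(x, y)\<in>R. cinner (A x) y = 0} = ?f -` (- ?C) \<inter> ?S"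
    by auto
  ultimately show ?thesis unfolding closedin_def by auto
qed

lemma F_infty_subset:
  assumes "op_algebra \<A>" "closedin wot \<A>" "id \<in> \<A>" "range creation \<subseteq> \<A>"
  shows "F_infty \<subseteq> \<A>"
  using assms unfolding F_infty_def by blast

lemma op_algebra_bounded_ops: "op_algebra (bounded_ops UNIV UNIV)"
  unfolding op_algebra_def op_subspace_def
  by (auto intro!: bounded_ops_zero bounded_ops_add bounded_ops_scaleC bounded_ops_comp complex_vector.subspace_UNIV)

lemma closedin_wot_bounded_ops: "closedin wot (bounded_ops UNIV UNIV)"
  using closedin_wot_orthogonal[of "{}"] by simp

lemma creation_bounded_ops: "creation i \<in> bounded_ops UNIV UNIV"
  by (simp add: creation_eq_left_shift left_shift_bounded_ops)

lemma F_infty_subset_bounded_ops: "F_infty \<subseteq> bounded_ops UNIV UNIV"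
  by (intro F_infty_subset op_algebra_bounded_ops closedin_wot_bounded_ops bounded_ops_id
      image_subsetI creation_bounded_ops)

lemma closedin_wot_F_infty: "closedin wot F_infty"
proof -
  have "bounded_ops UNIV UNIV \<in> {\<A>. op_algebra \<A> \<and> closedin wot \<A> \<and> id \<in> \<A> \<and> range creation \<subseteq> \<A>}"
    by (intro CollectI conjI op_algebra_bounded_ops closedin_wot_bounded_ops bounded_ops_id
        image_subsetI creation_bounded_ops)
  then show ?thesis unfolding F_infty_def by (intro closedin_Inter) auto
qed

lemma op_algebra_F_infty: "op_algebra F_infty"
  using F_infty_subset_bounded_ops unfolding F_infty_def op_algebra_def op_subspace_def by auto

context
  fixes S :: "'n :: finite fock set"
  assumes invariant: "\<And>i \<phi>. \<phi> \<in> orth_complement S \<Longrightarrow> creation i \<phi> \<in> orth_complement S"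
begin

text \<open>Operators leaving the complement of \<open>S\<close> invariant form an algebra
  containing the generators. It is WOT-closed, since invariance means that the coefficients between
  the complement and \<open>S\<close> vanish.\<close>

lemma F_infty_invariant:
  assumes "A \<in> F_infty" "\<phi> \<in> orth_complement S"
  shows "A \<phi> \<in> orth_complement S"
proof -
  let ?\<A> = "{A \<in> bounded_ops UNIV UNIV. \<forall>(x, y)\<in>orth_complement S \<times> S. cinner (A x) y = 0}"
  have eq: "?\<A> = {A \<in> bounded_ops UNIV UNIV. \<forall>x\<in>orth_complement S. A x \<in> orth_complement S}"
    by (auto simp: orth_complement_def)
  have "F_infty \<subseteq> ?\<A>"
  proof (rule F_infty_subset)
    show "op_algebra ?\<A>"
      unfolding eq op_algebra_def op_subspace_def
      by (auto intro!: bounded_ops_zero bounded_ops_add bounded_ops_scaleC bounded_ops_comp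
          complex_vector.subspace_UNIV complex_vector.subspace_0 complex_vector.subspace_add
          complex_vector.subspace_scale csubspace_orth_complement)
    show "range creation \<subseteq> ?\<A>" unfolding eq
      using invariant by (auto simp: creation_bounded_ops)
    show "id \<in> ?\<A>" unfolding eq by (auto simp: bounded_ops_id)
  qed (rule closedin_wot_orthogonal)
  then show ?thesis using assms unfolding eq by auto
qed

text \<open>The competitor in the minimality of \<open>J\<close> is an ideal for two different
  reasons: right multiplication does not enlarge a range, and left multiplication keeps it
  orthogonal to \<open>S\<close> by \<open>F_infty_invariant\<close>.\<close>

lemma wot_ideal_generated_range_orthogonal:
  assumes gen: "wot_ideal_generated_by J X"
    and X: "\<And>A \<phi>. A \<in> X \<Longrightarrow> A \<phi> \<in> orth_complement S"
    and A: "A \<in> J"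
  shows "A \<phi> \<in> orth_complement S"
proof -
  let ?C = "{A \<in> bounded_ops UNIV UNIV. \<forall>(x, y)\<in>UNIV \<times> S. cinner (A x) y = 0}"
  let ?J = "F_infty \<inter> ?C"
  have eq: "?J = {A \<in> F_infty. \<forall>x. A x \<in> orth_complement S}"
    using F_infty_subset_bounded_ops by (auto simp: orth_complement_def)
  have "wot_closed_ideal ?J"
    unfolding wot_closed_ideal_def
  proof (intro conjI)
    show "closedin wot ?J" by (intro closedin_Int closedin_wot_F_infty closedin_wot_orthogonal)
    show "op_subspace ?J"
      using op_algebra_F_infty F_infty_subset_bounded_ops
      unfolding eq op_algebra_def op_subspace_def
      by (auto intro!: complex_vector.subspace_0 complex_vector.subspace_add
          complex_vector.subspace_scale csubspace_orth_complement)
    show "\<forall>A\<in>F_infty. \<forall>B\<in>?J. A \<circ> B \<in> ?J \<and> B \<circ> A \<in> ?J"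
      using op_algebra_F_infty F_infty_invariant unfolding eq op_algebra_def by auto
  qed simp
  moreover have "X \<subseteq> ?J"
    using gen X unfolding eq wot_ideal_generated_by_def wot_closed_ideal_def by blast
  ultimately have "J \<subseteq> ?J" using gen unfolding wot_ideal_generated_by_def by blast
  then show ?thesis using A unfolding eq by blast
qed

lemma subset_N_space:
  assumes gen: "wot_ideal_generated_by J X"
    and X: "\<And>A \<phi>. A \<in> X \<Longrightarrow> A \<phi> \<in> orth_complement S"
  shows "S \<subseteq> N_space J"
proof
  fix y assume y: "y \<in> S"
  have "A \<phi> \<in> orth_complement {y}" if "A \<in> J" for A \<phi>
  proof -
    have "A \<phi> \<in> orth_complement S" using gen X that by (rule wot_ideal_generated_range_orthogonal)
    then show ?thesis using y by (simp add: orth_complement_def)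
  qed
  then have "closure (cspan {A \<phi> | A \<phi>. A \<in> J}) \<subseteq> orth_complement {y}"
    by (intro closure_cspan_subset csubspace_orth_complement closed_orth_complement) auto
  then have "cinner z y = 0" if "z \<in> closure (cspan {A \<phi> | A \<phi>. A \<in> J})" for z
    using that by (auto simp: orth_complement_def)
  then show "y \<in> N_space J"
    unfolding N_space_def orth_complement_def
    by (auto simp: cinner_commute[of y])
qed

end

lemma csubspace_N_space: "csubspace (N_space J)" and closed_N_space: "closed (N_space J)"
  by (simp_all add: N_space_def csubspace_orth_complement closed_orth_complement)

text \<open>\<open>ampliation\<close> is made by choice, so an operator with the prescribed values
  has to be exhibited: the compression of \<open>left_shift i\<close> to the tensor product.\<close>

lemma ampliation_constrained_shift:
  fixes D :: "'h :: chilbert_space set" and J :: "('n :: finite fock \<Rightarrow> 'n fock) set"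
  defines "R i \<equiv> ampliation (N_space J) D (constrained_shift J i)"
  shows "R i \<in> bounded_ops (hilbert_tensor (N_space J) D) (hilbert_tensor (N_space J) D)"
    and "f \<in> N_space J \<Longrightarrow> d \<in> D \<Longrightarrow> R i (tensor_vec f d) = tensor_vec (constrained_shift J i f) d"
proof -
  let ?N = "N_space J" and ?E = "hilbert_tensor (N_space J) D"
  note N = csubspace_N_space[of J] closed_N_space[of J]
  note E = csubspace_hilbert_tensor[of ?N D] closed_hilbert_tensor[of ?N D]
  let ?R = "\<lambda>x. orth_proj ?E (left_shift i x)"
  have "?R \<in> bounded_ops ?E ?E"
  proof (rule bounded_opsI[where C = 1])
    show "norm (?R x) \<le> 1 * norm x" for x
      using norm_orth_proj_le[OF E, of "left_shift i x"] by (simp add: norm_left_shift)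
  qed (simp_all add: orth_proj_in[OF E] orth_proj_add[OF E] orth_proj_scaleC[OF E]
      bounded_opsD[OF left_shift_bounded_ops])
  moreover have "?R (tensor_vec f d) = tensor_vec (constrained_shift J i f) d" if "f \<in> ?N" "d \<in> D" for f d
  proof (rule orth_proj_eqI[OF E])
    let ?p = "constrained_shift J i f"
    show "tensor_vec ?p d \<in> ?E"
      using that by (intro tensor_vec_in_hilbert_tensor) (auto simp: constrained_shift_def orth_proj_in[OF N])
    \<comment> \<open>The part cut off by the compression has first factor
      \<open>creation i f - ?p\<close>, which is orthogonal to \<open>N_space J\<close>; hence it is
      orthogonal to all elementary tensors and their closed span.\<close>
    have "?E \<subseteq> orth_complement {tensor_vec (creation i f - ?p) d}"
    proof (rule hilbert_tensor_subset)
      fix g e assume g: "g \<in> ?N"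
      have "cinner (creation i f - ?p) g = 0"
        using orth_proj_residual[OF N] g by (simp add: constrained_shift_def orth_complement_def)
      then have "cinner (tensor_vec g e) (tensor_vec (creation i f - ?p) d) = 0"
        by (subst cinner_commute) (simp add: cinner_tensor_vec)
      then show "tensor_vec g e \<in> orth_complement {tensor_vec (creation i f - ?p) d}"
        by (simp add: orth_complement_def)
    qed (auto intro: csubspace_orth_complement closed_orth_complement)
    moreover have "tensor_vec (creation i f) d - tensor_vec ?p d = tensor_vec (creation i f - ?p) d"
      by (rule ell2_eqI) (simp add: minus_ell2_nth tensor_vec.rep_eq complex_vector.scale_left_diff_distrib)
    ultimately show "left_shift i (tensor_vec f d) - tensor_vec ?p d \<in> orth_complement ?E"
      unfolding left_shift_tensor_vec
      by (auto simp: orth_complement_def cinner_commute[of "tensor_vec (creation i f - ?p) d"])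
  qed
  ultimately have ex: "\<exists>R. R \<in> bounded_ops ?E ?E \<and>
      (\<forall>f\<in>?N. \<forall>d\<in>D. R (tensor_vec f d) = tensor_vec (constrained_shift J i f) d)"
    by (intro exI[of _ ?R]) blast
  show "R i \<in> bounded_ops ?E ?E"
    and "f \<in> ?N \<Longrightarrow> d \<in> D \<Longrightarrow> R i (tensor_vec f d) = tensor_vec (constrained_shift J i f) d"
    using someI_ex[OF ex] by (auto simp: R_def ampliation_def)
qed

text \<open>This is the agreement of the adjoints of the compressed and the full shift at
  \<open>y\<close>, in the weak form applied to \<open>y = W h\<close>. On elementary tensors the
  projection may be dropped because the slices of \<open>y\<close> lie in \<open>N_space J\<close>;
  continuity in \<open>x\<close> does the rest.\<close>

lemma cinner_ampliation_constrained_shift: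
  fixes J :: "('n :: finite fock \<Rightarrow> 'n fock) set" and x y :: "('n list, 'h :: chilbert_space) ell2"
  assumes "x \<in> hilbert_tensor (N_space J) D"
    and y: "\<And>d. d \<in> D \<Longrightarrow> slice d y \<in> N_space J"
  shows "cinner (ampliation (N_space J) D (constrained_shift J i) x) y = cinner x (left_shift_adj i y)"
proof -
  let ?N = "N_space J" and ?E = "hilbert_tensor (N_space J) D"
  let ?R = "ampliation ?N D (constrained_shift J i)"
  note N = csubspace_N_space[of J] closed_N_space[of J]
  note E = csubspace_hilbert_tensor[of ?N D] closed_hilbert_tensor[of ?N D]
  note R = ampliation_constrained_shift[where J = J and D = D and i = i]
  define G where "G = {x \<in> ?E. cinner (?R x) y - cinner x (left_shift_adj i y) = 0}"
  have "csubspace G"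
    unfolding G_def using complex_vector.subspace_0[OF E(1)] bounded_opsD(3)[OF R(1), of 0 0]
    by (intro complex_vector.subspaceI)
       (auto simp: bounded_opsD[OF R(1)] cinner_add_left cinner_scaleC_left cinner.zero_left
          algebra_simps intro: complex_vector.subspace_add[OF E(1)] complex_vector.subspace_scale[OF E(1)])
  moreover have "closed G"
    unfolding G_def using bounded_ops_continuous_on[OF R(1) E(1)]
    by (intro continuous_closed_preimage_constant E continuous_intros cinner.continuous_on)
  moreover have "tensor_vec f d \<in> G" if "f \<in> ?N" "d \<in> D" for f d
  proof -
    have "cinner (?R (tensor_vec f d)) y = cinner (orth_proj ?N (creation i f)) (slice d y)"
      using that by (simp add: R(2) cinner_tensor_vec_left constrained_shift_def)
    also have "\<dots> = cinner (creation i f) (slice d y)"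
      using that by (intro cinner_orth_proj N y)
    also have "\<dots> = cinner (tensor_vec f d) (left_shift_adj i y)"
      by (simp add: creation_eq_left_shift cinner_left_shift left_shift_adj_slice cinner_tensor_vec_left)
    finally show ?thesis using that by (simp add: G_def tensor_vec_in_hilbert_tensor)
  qed
  ultimately have "?E \<subseteq> G" by (rule hilbert_tensor_subset)
  then show ?thesis using assms(1) by (auto simp: G_def)
qed

section \<open>Words in a row operator\<close>

lemma word_op_bounded_ops:
  assumes "\<And>i. T i \<in> bounded_ops M M"
  shows "word_op T \<alpha> \<in> bounded_ops M M"
proof (induction \<alpha>)
  case (Cons i \<alpha>)
  then show ?case unfolding word_op.simps by (rule bounded_ops_comp[OF assms])
qed (simp only: word_op.simps bounded_ops_id)

lemma adj_word_op_Nil: "adj (word_op T []) h = h"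
  by (rule adjoint_on_eqI) (auto simp: complex_vector.subspace_UNIV)

lemma adj_word_op_Cons:
  assumes "\<And>i. T i \<in> bounded_ops UNIV UNIV"
  shows "adj (word_op T (i # \<alpha>)) h = adj (word_op T \<alpha>) (adj (T i) h)"
  unfolding word_op.simps by (rule adj_comp[OF assms word_op_bounded_ops[OF assms]])

text \<open>An operator \<open>Y\<close> with \<open>Z\<^sub>i\<^sup>* Y = Y T\<^sub>i\<^sup>*\<close> transports polynomial relations from \<open>T\<close> to \<open>Z\<close>, weakly.\<close>

context
  fixes T :: "'n \<Rightarrow> 'h :: chilbert_space \<Rightarrow> 'h" and Z :: "'n \<Rightarrow> 'b :: complex_inner \<Rightarrow> 'b"
    and Y :: "'h \<Rightarrow> 'b" and M :: "'b set"
  assumes T: "\<And>i. T i \<in> bounded_ops UNIV UNIV"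
    and Z: "\<And>i x. x \<in> M \<Longrightarrow> Z i x \<in> M"
    and intertwine: "\<And>i x h. x \<in> M \<Longrightarrow> cinner (Z i x) (Y h) = cinner x (Y (adj (T i) h))"
begin

lemma cinner_word_op_intertwine:
  "x \<in> M \<Longrightarrow> word_op Z \<alpha> x \<in> M \<and> cinner (word_op Z \<alpha> x) (Y h) = cinner x (Y (adj (word_op T \<alpha>) h))"
proof (induction \<alpha> arbitrary: h)
  case (Cons i \<alpha>)
  then show ?case by (simp add: Z intertwine adj_word_op_Cons[OF T] del: word_op.simps) (simp add: Z intertwine)
qed (simp add: adj_word_op_Nil del: word_op.simps, simp)

lemma cinner_ncpoly_op_eq_0:
  assumes Y: "Y \<in> bounded_ops UNIV UNIV" and p: "\<And>g. ncpoly_op p T g = 0" and x: "x \<in> M"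
  shows "cinner (ncpoly_op p Z x) (Y h) = 0"
proof -
  note lin = bounded_linear.linear[OF bounded_ops_imp_bounded_linear[OF Y]]
  let ?c = "\<lambda>\<alpha>. Poly_Mapping.lookup p \<alpha>"
  let ?S = "\<lambda>\<alpha>. adj (word_op T \<alpha>) h"
  \<comment> \<open>The sum is the adjoint of \<open>ncpoly_op p T\<close> applied to
    \<open>h\<close>, which is why the coefficients are conjugated.\<close>
  have adj0: "(\<Sum>\<alpha>\<in>Poly_Mapping.keys p. scaleC (cnj (?c \<alpha>)) (?S \<alpha>)) = 0"
  proof (rule cinner_eqI)
    fix g
    have "cinner g (\<Sum>\<alpha>\<in>Poly_Mapping.keys p. scaleC (cnj (?c \<alpha>)) (?S \<alpha>)) = cinner (ncpoly_op p T g) h"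
      by (simp add: ncpoly_op_def cinner.sum_left cinner.sum_right cinner_scaleC_left cinner_scaleC_right
          cinner_adj word_op_bounded_ops T)
    then show "cinner g (\<Sum>\<alpha>\<in>Poly_Mapping.keys p. scaleC (cnj (?c \<alpha>)) (?S \<alpha>)) = cinner g 0"
      by (simp add: p cinner.zero_left cinner.zero_right)
  qed
  have "cinner (ncpoly_op p Z x) (Y h) = (\<Sum>\<alpha>\<in>Poly_Mapping.keys p. cinner x (Y (scaleC (cnj (?c \<alpha>)) (?S \<alpha>))))"
    using cinner_word_op_intertwine[OF x]
    by (simp add: ncpoly_op_def cinner.sum_left cinner_scaleC_left bounded_opsD(3)[OF Y] cinner_scaleC_right)
  also have "\<dots> = cinner x (Y (\<Sum>\<alpha>\<in>Poly_Mapping.keys p. scaleC (cnj (?c \<alpha>)) (?S \<alpha>)))"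
    by (simp only: cinner.sum_right linear_sum[OF lin])
  finally show ?thesis by (simp add: adj0 linear_0[OF lin] cinner.zero_right)
qed

end

section \<open>Sums over words, graded by length\<close>

lemma finite_words: "finite {\<alpha> :: 'n :: finite list. length \<alpha> = k}" "finite {\<alpha> :: 'n :: finite list. length \<alpha> < k}"
  using finite_lists_length_eq[of "UNIV :: 'n set" k] finite_lists_length_le[of "UNIV :: 'n set" k]
  by (auto elim: rev_finite_subset)

lemma sum_words_Cons:
  fixes f :: "'n :: finite list \<Rightarrow> 'b :: comm_monoid_add"
  shows "sum f ((\<lambda>(i, \<alpha>). i # \<alpha>) ` (UNIV \<times> W)) = (\<Sum>i\<in>UNIV. \<Sum>\<alpha>\<in>W. f (i # \<alpha>))"
  by (subst sum.reindex) (auto simp: inj_on_def sum.cartesian_product intro!: sum.cong)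

lemma sum_words_length_Suc:
  fixes f :: "'n :: finite list \<Rightarrow> 'b :: comm_monoid_add"
  shows "(\<Sum>\<alpha> | length \<alpha> = Suc k. f \<alpha>) = (\<Sum>i\<in>UNIV. \<Sum>\<alpha> | length \<alpha> = k. f (i # \<alpha>))"
proof -
  have "{\<alpha>. length \<alpha> = Suc k} = (\<lambda>(i, \<alpha>). i # \<alpha>) ` (UNIV \<times> {\<alpha> :: 'n list. length \<alpha> = k})"
    by (auto simp: length_Suc_conv image_iff)
  then show ?thesis by (simp only: sum_words_Cons)
qed

lemma sum_words_length_less_Suc:
  fixes f :: "'n :: finite list \<Rightarrow> 'b :: comm_monoid_add"
  shows "(\<Sum>\<alpha> | length \<alpha> < Suc k. f \<alpha>) = f [] + (\<Sum>i\<in>UNIV. \<Sum>\<alpha> | length \<alpha> < k. f (i # \<alpha>))"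
proof -
  let ?W = "(\<lambda>(i, \<alpha>). i # \<alpha>) ` (UNIV \<times> {\<alpha> :: 'n list. length \<alpha> < k})"
  have "{\<alpha>. length \<alpha> < Suc k} = insert [] ?W"
  proof (rule set_eqI)
    show "\<alpha> \<in> {\<alpha>. length \<alpha> < Suc k} \<longleftrightarrow> \<alpha> \<in> insert [] ?W" for \<alpha>
      by (cases \<alpha>) (auto simp: image_iff)
  qed
  moreover have "finite ?W" using finite_words(2) by (intro finite_imageI finite_cartesian_product) auto
  moreover have "[] \<notin> ?W" by auto
  ultimately show ?thesis by (simp only: sum.insert sum_words_Cons not_False_eq_True)
qed

text \<open>Lets the unordered sum behind the norm of \<open>poisson_kernel T h\<close> be evaluated
  along increasing word length.\<close>

lemma filterlim_words_finite_subsets: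
  "filterlim (\<lambda>k. {\<alpha> :: 'n :: finite list. length \<alpha> < k}) (finite_subsets_at_top UNIV) sequentially"
  unfolding filterlim_finite_subsets_at_top
proof (intro allI impI)
  fix F :: "'n list set" assume F: "finite F \<and> F \<subseteq> UNIV"
  \<comment> \<open>Exceeds every length occurring in \<open>F\<close>; the inserted 0 keeps
    \<open>Max\<close> meaningful when \<open>F\<close> is empty.\<close>
  define m where "m = Suc (Max (insert 0 (length ` F)))"
  have "length \<alpha> < k" if "\<alpha> \<in> F" "m \<le> k" for \<alpha> k
  proof -
    have "length \<alpha> \<le> Max (insert 0 (length ` F))" using F that by (intro Max_ge) auto
    then show ?thesis using that by (simp add: m_def)
  qed
  then show "\<forall>\<^sub>F k in sequentially. finite {\<alpha> :: 'n list. length \<alpha> < k} \<and> F \<subseteq> {\<alpha>. length \<alpha> < k} \<and> {\<alpha>. length \<alpha> < k} \<subseteq> UNIV"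
    unfolding eventually_sequentially using finite_words(2) by blast
qed

section \<open>The Poisson kernel of a row contraction\<close>

text \<open>The map \<open>W\<close>. \<open>Abs_ell2\<close> has the intended coordinates only for
  square-summable families, so they become available in \<open>poisson_kernel_nth\<close>, once
  \<open>T\<close> is known to be a row contraction.\<close>

definition poisson_kernel :: "('n :: finite \<Rightarrow> 'h :: chilbert_space \<Rightarrow> 'h) \<Rightarrow> 'h \<Rightarrow> ('n list, 'h) ell2" where
  "poisson_kernel T h = Abs_ell2 (\<lambda>\<alpha>. defect_op T (adj (word_op T \<alpha>) h))"

context
  fixes T :: "'n :: finite \<Rightarrow> 'h :: chilbert_space \<Rightarrow> 'h"
  assumes T: "row_contraction T"
begin

lemma row_bounded_ops: "T i \<in> bounded_ops UNIV UNIV"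
  using T by (simp add: row_contraction_def)

lemma cinner_one_minus_row:
  "cinner (x - (\<Sum>i\<in>UNIV. T i (adj (T i) x))) y = cinner x y - (\<Sum>i\<in>UNIV. cinner (adj (T i) x) (adj (T i) y))"
  by (simp add: cinner.diff_left cinner.sum_left cinner_adj[OF row_bounded_ops])

lemma positive_defect_op: "positive_op (defect_op T)"
  and cinner_defect_op: "cinner (defect_op T x) (defect_op T y) =
    cinner x y - (\<Sum>i\<in>UNIV. cinner (adj (T i) x) (adj (T i) y))"
proof -
  have pos: "positive_op (\<lambda>h. h - (\<Sum>i\<in>UNIV. T i (adj (T i) h)))" using T by (simp add: row_contraction_def)
  have le: "Re (cinner (x - (\<Sum>i\<in>UNIV. T i (adj (T i) x))) x) \<le> (norm x)\<^sup>2" for x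
    by (simp add: cinner_one_minus_row cinner_self_eq_norm sum_nonneg)
  show "positive_op (defect_op T)"
    unfolding defect_op_def using pos le by (rule positive_sqrt_op)
  show "cinner (defect_op T x) (defect_op T y) =
    cinner x y - (\<Sum>i\<in>UNIV. cinner (adj (T i) x) (adj (T i) y))"
    unfolding defect_op_def using cinner_sqrt_op[OF pos le] by (simp add: cinner_one_minus_row)
qed

lemma norm_defect_op: "(norm (defect_op T x))\<^sup>2 = (norm x)\<^sup>2 - (\<Sum>i\<in>UNIV. (norm (adj (T i) x))\<^sup>2)"
  by (simp add: norm_square_eq_cinner cinner_defect_op)

text \<open>A telescoping of \<open>norm_defect_op\<close>: the energy at one word length is the
  defect there plus the energy at the next length. The induction peels off the first letter, which
  replaces \<open>h\<close> by \<open>adj (T i) h\<close>, so \<open>h\<close> must be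
  arbitrary.\<close>

lemma sum_defect_words:
  "(\<Sum>\<alpha> | length \<alpha> < k. (norm (defect_op T (adj (word_op T \<alpha>) h)))\<^sup>2) +
    (\<Sum>\<alpha> | length \<alpha> = k. (norm (adj (word_op T \<alpha>) h))\<^sup>2) = (norm h)\<^sup>2"
proof (induction k arbitrary: h)
  case 0
  then show ?case by (simp add: adj_word_op_Nil del: word_op.simps)
next
  case (Suc k)
  have "(\<Sum>\<alpha> | length \<alpha> < Suc k. (norm (defect_op T (adj (word_op T \<alpha>) h)))\<^sup>2) +
      (\<Sum>\<alpha> | length \<alpha> = Suc k. (norm (adj (word_op T \<alpha>) h))\<^sup>2) =
    (norm (defect_op T h))\<^sup>2 + (\<Sum>i\<in>UNIV. (norm (adj (T i) h))\<^sup>2)"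
    unfolding sum_words_length_Suc sum_words_length_less_Suc
    by (simp add: adj_word_op_Cons[OF row_bounded_ops] adj_word_op_Nil sum.distrib[symmetric] Suc del: word_op.simps)
  then show ?case by (simp add: norm_defect_op)
qed

lemma sum_words_le: "(\<Sum>\<alpha> | length \<alpha> = k. (norm (adj (word_op T \<alpha>) h))\<^sup>2) \<le> (norm h)\<^sup>2"
proof -
  have "0 \<le> (\<Sum>\<alpha> | length \<alpha> < k. (norm (defect_op T (adj (word_op T \<alpha>) h)))\<^sup>2)" by (simp add: sum_nonneg)
  then show ?thesis using sum_defect_words[where k = k and h = h] by linarith
qed

lemma sum_defect_words_le:
  assumes "finite F"
  shows "(\<Sum>\<alpha>\<in>F. (norm (defect_op T (adj (word_op T \<alpha>) h)))\<^sup>2) \<le> (norm h)\<^sup>2"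
proof -
  define k where "k = Suc (Max (insert 0 (length ` F)))"
  have "F \<subseteq> {\<alpha>. length \<alpha> < k}" using assms by (auto simp: k_def less_Suc_eq_le)
  then have "(\<Sum>\<alpha>\<in>F. (norm (defect_op T (adj (word_op T \<alpha>) h)))\<^sup>2)
      \<le> (\<Sum>\<alpha> | length \<alpha> < k. (norm (defect_op T (adj (word_op T \<alpha>) h)))\<^sup>2)"
    by (intro sum_mono2 finite_words) auto
  also have "\<dots> \<le> (norm h)\<^sup>2"
  proof -
    have "0 \<le> (\<Sum>\<alpha> | length \<alpha> = k. (norm (adj (word_op T \<alpha>) h))\<^sup>2)" by (simp add: sum_nonneg)
    then show ?thesis using sum_defect_words[where k = k and h = h] by linarith
  qed
  finally show ?thesis .
qed

lemma poisson_kernel_nth: "ell2_nth (poisson_kernel T h) \<alpha> = defect_op T (adj (word_op T \<alpha>) h)"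
proof -
  have "(\<lambda>\<alpha>. (norm (defect_op T (adj (word_op T \<alpha>) h)))\<^sup>2) summable_on UNIV"
    by (rule nonneg_bdd_above_summable_on)
       (auto intro!: bdd_aboveI2[where M = "(norm h)\<^sup>2"] sum_defect_words_le)
  then show ?thesis by (simp add: poisson_kernel_def Abs_ell2_inverse)
qed

lemma norm_poisson_kernel_le: "norm (poisson_kernel T h) \<le> norm h"
  by (rule norm_ell2_leI) (simp_all add: poisson_kernel_nth sum_defect_words_le)

lemma poisson_kernel_bounded_ops: "poisson_kernel T \<in> bounded_ops UNIV UNIV"
proof (rule bounded_opsI[where C = 1])
  note adjD = bounded_opsD[OF adj_bounded_ops[OF word_op_bounded_ops[OF row_bounded_ops]]]
    and defD = bounded_opsD[OF positive_op_bounded_ops[OF positive_defect_op]]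
  show "poisson_kernel T (x + y) = poisson_kernel T x + poisson_kernel T y" for x y
    by (rule ell2_eqI) (simp add: poisson_kernel_nth plus_ell2.rep_eq adjD defD)
  show "poisson_kernel T (scaleC c x) = scaleC c (poisson_kernel T x)" for c x
    by (rule ell2_eqI) (simp add: poisson_kernel_nth scaleC_ell2.rep_eq adjD defD)
qed (simp_all add: norm_poisson_kernel_le)

lemma left_shift_adj_poisson_kernel:
  "left_shift_adj i (poisson_kernel T h) = poisson_kernel T (adj (T i) h)"
  by (rule ell2_eqI)
     (simp add: left_shift_adj.rep_eq poisson_kernel_nth adj_word_op_Cons[OF row_bounded_ops] del: word_op.simps)

lemma cinner_poisson_kernel:
  "cinner (poisson_kernel T x) (poisson_kernel T y) = cinner (defect_op T x) (defect_op T y)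
    + (\<Sum>i\<in>UNIV. cinner (poisson_kernel T (adj (T i) x)) (poisson_kernel T (adj (T i) y)))"
  by (subst cinner_ell2_words) (simp add: left_shift_adj_poisson_kernel poisson_kernel_nth adj_word_op_Nil del: word_op.simps)

lemma sum_words_tendsto:
  "(\<lambda>k. \<Sum>\<alpha> | length \<alpha> = k. (norm (adj (word_op T \<alpha>) h))\<^sup>2)
    \<longlonglongrightarrow> (norm h)\<^sup>2 - (norm (poisson_kernel T h))\<^sup>2"
proof -
  let ?f = "\<lambda>\<alpha>. (norm (defect_op T (adj (word_op T \<alpha>) h)))\<^sup>2"
  have "(?f has_sum (norm (poisson_kernel T h))\<^sup>2) UNIV"
    using has_sum_infsum[OF summable_ell2[of "poisson_kernel T h"]]
    by (simp add: norm_ell2_def infsum_nonneg poisson_kernel_nth)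
  then have "(\<lambda>k. \<Sum>\<alpha> | length \<alpha> < k. ?f \<alpha>) \<longlonglongrightarrow> (norm (poisson_kernel T h))\<^sup>2"
    unfolding has_sum_def by (rule filterlim_compose[OF _ filterlim_words_finite_subsets])
  then have "(\<lambda>k. (norm h)\<^sup>2 - (\<Sum>\<alpha> | length \<alpha> < k. ?f \<alpha>)) \<longlonglongrightarrow> (norm h)\<^sup>2 - (norm (poisson_kernel T h))\<^sup>2"
    by (intro tendsto_diff tendsto_const)
  moreover have "(norm h)\<^sup>2 - (\<Sum>\<alpha> | length \<alpha> < k. ?f \<alpha>) = (\<Sum>\<alpha> | length \<alpha> = k. (norm (adj (word_op T \<alpha>) h))\<^sup>2)" for k
    using sum_defect_words[where k = k and h = h] by simp
  ultimately show ?thesis by simp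
qed

text \<open>\<open>sum_words_tendsto\<close> controls only the quadratic forms of the operators
  \<open>A k\<close>, whereas purity asks for norm convergence of \<open>A k h\<close>. The gap is
  closed by \<open>0 \<le> A k \<le> I\<close>, which gives
  \<open>|A k h|^2 \<le> cinner (A k h) h\<close>.\<close>

lemma pure_iff_poisson_kernel_isometric:
  "pure_row_contraction T \<longleftrightarrow> (\<forall>h. norm (poisson_kernel T h) = norm h)"
proof -
  define A where "A k h = (\<Sum>\<alpha> | length \<alpha> = k. word_op T \<alpha> (adj (word_op T \<alpha>) h))" for k h
  note wb = word_op_bounded_ops[OF row_bounded_ops]
  have cA: "cinner (A k x) y = (\<Sum>\<alpha> | length \<alpha> = k. cinner (adj (word_op T \<alpha>) x) (adj (word_op T \<alpha>) y))" for k x y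
    by (simp add: A_def cinner.sum_left cinner_adj[OF wb])
  have ReA: "Re (cinner (A k x) x) = (\<Sum>\<alpha> | length \<alpha> = k. (norm (adj (word_op T \<alpha>) x))\<^sup>2)" for k x
    by (simp add: cA norm_square_eq_cinner)
  have Apos: "positive_op (A k)" for k
  proof (rule positive_opI)
    have "A k = (\<lambda>h. \<Sum>\<alpha> | length \<alpha> = k. (word_op T \<alpha> \<circ> adj (word_op T \<alpha>)) h)"
      by (auto simp: A_def)
    then show "A k \<in> bounded_ops UNIV UNIV"
      by (simp only:) (intro bounded_ops_sum bounded_ops_comp[OF wb adj_bounded_ops[OF wb]] complex_vector.subspace_UNIV)
    show "cinner (A k x) y = cinner x (A k y)" for x y
      by (subst (2) cinner_commute) (simp add: cA cinner_commute[of "adj (word_op T _) x"])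
    show "0 \<le> Re (cinner (A k x) x)" for x by (simp add: ReA sum_nonneg)
  qed
  have norm_le: "(norm (A k h))\<^sup>2 \<le> Re (cinner (A k h) h)" for k h
    by (rule positive_contraction_norm_square_le[OF Apos]) (simp add: ReA sum_words_le)
  have lim: "(\<lambda>k. Re (cinner (A k h) h)) \<longlonglongrightarrow> (norm h)\<^sup>2 - (norm (poisson_kernel T h))\<^sup>2" for h
    unfolding ReA by (rule sum_words_tendsto)
  have "(\<lambda>k. A k h) \<longlonglongrightarrow> 0 \<longleftrightarrow> norm (poisson_kernel T h) = norm h" for h
  proof
    assume "(\<lambda>k. A k h) \<longlonglongrightarrow> 0"
    then have "(\<lambda>k. Re (cinner (A k h) h)) \<longlonglongrightarrow> Re (cinner 0 h)"
      by (intro tendsto_Re cinner.tendsto tendsto_const)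
    then have "(norm h)\<^sup>2 - (norm (poisson_kernel T h))\<^sup>2 = 0"
      using LIMSEQ_unique[OF lim] by (fastforce simp: cinner.zero_left)
    then show "norm (poisson_kernel T h) = norm h" by simp
  next
    assume "norm (poisson_kernel T h) = norm h"
    then have "(\<lambda>k. Re (cinner (A k h) h)) \<longlonglongrightarrow> 0" using lim[of h] by simp
    then have "(\<lambda>k. (norm (A k h))\<^sup>2) \<longlonglongrightarrow> 0"
      by (rule Lim_null_comparison[rotated]) (simp add: norm_le)
    then have "(\<lambda>k. sqrt ((norm (A k h))\<^sup>2)) \<longlonglongrightarrow> sqrt 0" by (rule tendsto_real_sqrt)
    then show "(\<lambda>k. A k h) \<longlonglongrightarrow> 0" by (simp add: tendsto_norm_zero_iff)
  qed
  then show ?thesis using T by (simp add: pure_row_contraction_def A_def)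
qed

lemma poisson_kernel_in_tensor:
  fixes J :: "('n fock \<Rightarrow> 'n fock) set"
  defines "D \<equiv> closure (range (defect_op T))"
  assumes gen: "wot_ideal_generated_by J ((\<lambda>p. ncpoly_op p creation) ` P)"
    and P: "\<forall>p\<in>P. \<forall>h. ncpoly_op p T h = 0"
  shows slice_poisson_kernel_in_N_space: "slice d (poisson_kernel T h) \<in> N_space J"
    and "poisson_kernel T h \<in> hilbert_tensor (N_space J) D"
proof -
  let ?Y = "\<lambda>d h. slice d (poisson_kernel T h)"
  have inter: "cinner (creation i \<phi>) (?Y d h) = cinner \<phi> (?Y d (adj (T i) h))" for i \<phi> d h
    by (simp add: creation_eq_left_shift cinner_left_shift left_shift_adj_slice left_shift_adj_poisson_kernel)
  have Yb: "?Y d \<in> bounded_ops UNIV UNIV" for d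
    using bounded_ops_comp[OF slice_bounded_ops poisson_kernel_bounded_ops] by (simp add: comp_def)
  \<comment> \<open>Letting \<open>h\<close> range over the whole space makes \<open>S\<close>
    stable under the adjoint shifts, which send the slice at \<open>h\<close> to the slice at
    \<open>adj (T i) h\<close>. Hence its complement is invariant under
    \<open>creation i\<close>.\<close>
  define S where "S = {?Y d h | d h. True}"
  have "S \<subseteq> N_space J"
  proof (rule subset_N_space[OF _ gen])
    show "creation i \<phi> \<in> orth_complement S" if "\<phi> \<in> orth_complement S" for i \<phi>
      unfolding orth_complement_def
    proof (intro CollectI ballI)
      fix y assume "y \<in> S"
      then obtain d h where y: "y = ?Y d h" unfolding S_def by blast
      have "?Y d (adj (T i) h) \<in> S" unfolding S_def by blast
      then show "cinner (creation i \<phi>) y = 0" using that unfolding y inter by (simp add: orth_complement_def)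
    qed
    show "A \<phi> \<in> orth_complement S" if "A \<in> (\<lambda>p. ncpoly_op p creation) ` P" for A \<phi>
    proof -
      obtain p where p: "p \<in> P" "A = ncpoly_op p creation" using \<open>A \<in> _\<close> by blast
      have "cinner (ncpoly_op p creation \<phi>) (?Y d h) = 0" for d h
        by (rule cinner_ncpoly_op_eq_0[where Z = creation and Y = "?Y d" and T = T and M = UNIV])
           (simp_all add: row_bounded_ops inter Yb P p)
      then show ?thesis by (auto simp: p orth_complement_def S_def)
    qed
  qed
  then show slice: "slice d (poisson_kernel T h) \<in> N_space J" for d by (auto simp: S_def)
  have D: "csubspace D" "closed D"
    unfolding D_def
    by (auto intro: csubspace_closure csubspace_range[OF positive_op_bounded_ops[OF positive_defect_op]])
  have "ell2_nth (poisson_kernel T h) \<alpha> \<in> D" for \<alpha>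
    unfolding poisson_kernel_nth D_def by (rule subsetD[OF closure_subset]) simp
  then show "poisson_kernel T h \<in> hilbert_tensor (N_space J) D"
    by (intro hilbert_tensor_memI csubspace_N_space closed_N_space D slice)
qed

end

section \<open>The coisometric part\<close>

text \<open>\<open>R\<close> is the root of \<open>Q = I - W^* W\<close>, which lies between 0 and
  \<open>I\<close>. Only its Gram identity is exported: it yields the isometry, the coisometric row
  and the criterion for purity.\<close>

lemma contraction_complement:
  fixes W :: "'h :: chilbert_space \<Rightarrow> 'b :: complex_inner"
  assumes W: "W \<in> bounded_ops UNIV UNIV" and le: "\<And>h. norm (W h) \<le> norm h"
  obtains R :: "'h \<Rightarrow> 'h" where "R \<in> bounded_ops UNIV UNIV"
    "\<And>x y. cinner (R x) (R y) = cinner x y - cinner (W x) (W y)"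
proof -
  have "\<exists>z. \<forall>y. cinner (W y) (W x) = cinner y z" for x
    using adjoint_exists[OF W complex_vector.subspace_UNIV closed_UNIV] by auto
  then obtain V where V: "\<And>x y. cinner (W y) (W x) = cinner y (V x)" by metis
  define Q where "Q x = x - V x" for x
  have Q: "cinner y (Q x) = cinner y x - cinner (W y) (W x)" for x y
    by (simp add: Q_def cinner.diff_right V)
  then have Q': "cinner (Q x) y = cinner x y - cinner (W x) (W y)" for x y
    by (subst (1 2 3) cinner_commute) simp
  have ReQ: "Re (cinner (Q x) x) = (norm x)\<^sup>2 - (norm (W x))\<^sup>2" for x
    by (simp add: Q' norm_square_eq_cinner)
  have "positive_op Q"
  proof (rule positive_opI)
    show "cinner (Q x) y = cinner x (Q y)" for x y by (simp add: Q Q')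
    show "0 \<le> Re (cinner (Q x) x)" for x using le by (simp add: ReQ power_mono)
    show "Q \<in> bounded_ops UNIV UNIV"
    \<comment> \<open>One unit for the identity and one for \<open>W^* W\<close>, both
      contractive.\<close>
    proof (rule bounded_opsI[where C = 2])
      show "Q (x + y) = Q x + Q y" for x y
        by (rule cinner_eqI) (simp add: Q bounded_opsD[OF W] cinner_add_right)
      show "Q (scaleC c x) = scaleC c (Q x)" for c x
        by (rule cinner_eqI) (simp add: Q bounded_opsD[OF W] cinner_scaleC_right algebra_simps)
      show "norm (Q x) \<le> 2 * norm x" for x
      proof -
        have "(norm (Q x))\<^sup>2 = cmod (cinner (Q x) x - cinner (W (Q x)) (W x))"
          unfolding Q[symmetric] by (simp add: cinner_self_eq_norm norm_power)
        also have "\<dots> \<le> cmod (cinner (Q x) x) + cmod (cinner (W (Q x)) (W x))" by (rule norm_triangle_ineq4)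
        also have "\<dots> \<le> norm (Q x) * norm x + norm (W (Q x)) * norm (W x)"
          by (intro add_mono cmod_cinner_le_norm_mult)
        also have "\<dots> \<le> norm (Q x) * norm x + norm (Q x) * norm x"
          by (intro add_left_mono mult_mono le) auto
        finally have "norm (Q x) * norm (Q x) \<le> norm (Q x) * (2 * norm x)"
          by (simp add: power2_eq_square mult_ac)
        then show ?thesis by (cases "norm (Q x) = 0") (simp_all add: mult_le_cancel_left)
      qed
    qed simp
  qed
  moreover have "Re (cinner (Q x) x) \<le> (norm x)\<^sup>2" for x by (simp add: ReQ)
  ultimately have "positive_op (sqrt_op Q)" "\<And>x y. cinner (sqrt_op Q x) (sqrt_op Q y) = cinner (Q x) y"
    by (auto intro: positive_sqrt_op cinner_sqrt_op)
  then show ?thesis using that[of "sqrt_op Q"] by (simp add: Q' positive_op_bounded_ops)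
qed

text \<open>What is given on the dense range of \<open>X\<close> is the future adjoint
  \<open>L i\<close>, sending \<open>X h\<close> to \<open>X (S i h)\<close>. The Gram identity says
  that the column of the \<open>L i\<close> is isometric, so each entry is contractive and extends
  to \<open>K\<close>; the identity extends one variable at a time. Then \<open>Z i\<close> is the
  adjoint of \<open>L i\<close>, and the coisometry relation of the row is the isometry of the
  column.\<close>

lemma coisometric_row_exists:
  fixes X :: "'h :: chilbert_space \<Rightarrow> 'b :: chilbert_space" and S :: "'n :: finite \<Rightarrow> 'h \<Rightarrow> 'h"
  defines "K \<equiv> closure (range X)"
  assumes X: "X \<in> bounded_ops UNIV UNIV" and S: "\<And>i. S i \<in> bounded_ops UNIV UNIV"
    and eq: "\<And>x y. cinner (X x) (X y) = (\<Sum>i\<in>UNIV. cinner (X (S i x)) (X (S i y)))"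
  shows "\<exists>Z. (\<forall>i. Z i \<in> bounded_ops K K) \<and>
    (\<forall>x\<in>K. (\<Sum>i\<in>UNIV. Z i (adjoint_on K (Z i) x)) = x) \<and>
    (\<forall>i. \<forall>x\<in>K. \<forall>h. cinner (Z i x) (X h) = cinner x (X (S i h)))"
proof -
  have K: "csubspace K" "closed K" unfolding K_def by (auto intro: csubspace_closure csubspace_range[OF X])
  have XK: "X h \<in> K" for h unfolding K_def by (rule subsetD[OF closure_subset]) simp
  have "\<exists>L. L \<in> bounded_ops K K \<and> (\<forall>h. L (X h) = X (S i h))" for i
  proof -
    have "norm (X (S i h)) \<le> norm (X h)" for h
    proof (rule power2_le_imp_le)
      have "(norm (X (S i h)))\<^sup>2 \<le> (\<Sum>i\<in>UNIV. (norm (X (S i h)))\<^sup>2)"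
        by (rule member_le_sum) auto
      also have "\<dots> = (norm (X h))\<^sup>2" by (simp add: norm_square_eq_cinner eq[of h h])
      finally show "(norm (X (S i h)))\<^sup>2 \<le> (norm (X h))\<^sup>2" .
    qed simp
    then have "norm ((X \<circ> S i) h) \<le> norm (X h)" for h by simp
    then obtain L where L: "L \<in> bounded_ops K (closure (range (X \<circ> S i)))" "\<And>h. L (X h) = (X \<circ> S i) h"
      using extend_dominated_operator[OF X bounded_ops_comp[OF X S]] unfolding K_def by metis
    moreover have "closure (range (X \<circ> S i)) \<subseteq> K" unfolding K_def by (rule closure_mono) auto
    ultimately have "L \<in> bounded_ops K K" unfolding bounded_ops_def by blast
    then show ?thesis using L(2) by auto
  qed
  then obtain L where L: "\<And>i. L i \<in> bounded_ops K K" and LX: "\<And>i h. L i (X h) = X (S i h)" by metis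
  have dense: "y \<in> K \<Longrightarrow> g y = 0" if "continuous_on K g" "\<And>h. g (X h) = 0" for g :: "'b \<Rightarrow> complex" and y
    using continuous_closed_preimage_constant[OF that(1) K(2), of 0] that(2) XK
      closure_minimal[of "range X" "{x \<in> K. g x = 0}"] unfolding K_def by blast
  note cont = bounded_ops_continuous_on[OF L K(1)]
  have iso: "(\<Sum>i\<in>UNIV. cinner (L i x) (L i y)) - cinner x y = 0" if "x \<in> K" "y \<in> K" for x y
  proof (rule dense[of "\<lambda>x. (\<Sum>i\<in>UNIV. cinner (L i x) (L i y)) - cinner x y"])
    fix h
    show "(\<Sum>i\<in>UNIV. cinner (L i (X h)) (L i y)) - cinner (X h) y = 0"
    proof (rule dense[of "\<lambda>y. (\<Sum>i\<in>UNIV. cinner (L i (X h)) (L i y)) - cinner (X h) y"])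
      show "(\<Sum>i\<in>UNIV. cinner (L i (X h)) (L i (X k))) - cinner (X h) (X k) = 0" for k
        by (simp add: LX eq[of h k])
    qed (intro continuous_intros cinner.continuous_on cont that)+
  qed (intro continuous_intros cinner.continuous_on cont that)+
  define Z where "Z i = adjoint_on K (L i)" for i
  show ?thesis
  proof (intro exI[of _ Z] conjI allI ballI)
    show "Z i \<in> bounded_ops K K" for i unfolding Z_def by (intro adjoint_on_bounded_ops L K)
    show "(\<Sum>i\<in>UNIV. Z i (adjoint_on K (Z i) x)) = x" if x: "x \<in> K" for x
    proof (rule eq_if_cinner_eq[OF K(1) _ x])
      show "(\<Sum>i\<in>UNIV. Z i (adjoint_on K (Z i) x)) \<in> K"
        unfolding Z_def by (intro complex_vector.subspace_sum K adjoint_on_in L)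
      show "cinner y (\<Sum>i\<in>UNIV. Z i (adjoint_on K (Z i) x)) = cinner y x" if "y \<in> K" for y
        using iso[OF that x] that x
        by (simp add: Z_def adjoint_on_adjoint_on[OF L K] cinner.sum_right cinner_adjoint_on[OF L K, symmetric])
    qed
    show "cinner (Z i x) (X h) = cinner x (X (S i h))" if "x \<in> K" for i x h
      unfolding LX[symmetric] Z_def using cinner_adjoint_on[OF L K XK, of i h x]
      by (subst (1 2) cinner_commute) simp
  qed
qed

lemma closed_range_isometry:
  fixes G :: "'a :: chilbert_space \<Rightarrow> 'b :: chilbert_space"
  assumes G: "G \<in> bounded_ops UNIV N" and iso: "\<And>h. norm (G h) = norm h"
  shows "closed (range G)"
proof -
  have "complete (range G)"
    using iso by (intro complete_isometric_image[of 1] bounded_ops_imp_bounded_linear[OF G])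
      (auto simp: complete_UNIV)
  then show ?thesis by (rule complete_imp_closed)
qed

theorem theorem2p1:
  fixes P :: "'n :: finite ncpoly set"
    and J :: "('n fock \<Rightarrow> 'n fock) set"
    and T :: "'n \<Rightarrow> 'h :: chilbert_space \<Rightarrow> 'h"
  assumes "wot_ideal_generated_by J ((\<lambda>p. ncpoly_op p creation) ` P)"
    and "J \<noteq> F_infty"
    and "row_contraction T"
    and "\<forall>p\<in>P. \<forall>h. ncpoly_op p T h = 0"
  shows "\<exists>(K :: ('n list, 'h) ell2 set) Z.
      csubspace K \<and> closed K \<and>
      (\<forall>i. Z i \<in> bounded_ops K K) \<and>
      (\<forall>x\<in>K. (\<Sum>i\<in>UNIV. Z i (adjoint_on K (Z i) x)) = x) \<and>
      (\<forall>p\<in>P. \<forall>x\<in>K. ncpoly_op p Z x = 0) \<and>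
      (let N = N_space J;
           D = closure (range (defect_op T));
           Kt = hilbert_tensor N D \<times> K;
           V = (\<lambda>i. map_prod (ampliation N D (constrained_shift J i)) (Z i))
       in \<exists>\<Gamma>. \<Gamma> \<in> bounded_ops UNIV Kt \<and> (\<forall>h. norm (\<Gamma> h) = norm h) \<and>
            co_invariant Kt (range V) (range \<Gamma>) \<and>
            (\<forall>i h. \<Gamma> (adj (T i) h) = adjoint_on Kt (V i) (\<Gamma> h))) \<and>
      (K = {0} \<longleftrightarrow> pure_row_contraction T)"
proof -
  note gen = assms(1) and T = assms(3) and P = assms(4)
  note Tb = row_bounded_ops[OF T]
  define W where "W = poisson_kernel T"
  have Wb: "W \<in> bounded_ops UNIV UNIV" unfolding W_def by (rule poisson_kernel_bounded_ops[OF T])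
  obtain R :: "'h \<Rightarrow> 'h" where Rb: "R \<in> bounded_ops UNIV UNIV"
    and R: "\<And>x y. cinner (R x) (R y) = cinner x y - cinner (W x) (W y)"
    using contraction_complement[OF Wb] norm_poisson_kernel_le[OF T] unfolding W_def by metis
  \<comment> \<open>Only a copy of \<open>range R\<close> inside the given type is needed, so \<open>R\<close> is placed at the empty word.\<close>
  define X :: "'h \<Rightarrow> ('n list, 'h) ell2" where "X = ell2_single [] \<circ> R"
  have Xb: "X \<in> bounded_ops UNIV UNIV"
    unfolding X_def by (rule bounded_ops_comp[OF ell2_single_bounded_ops Rb])
  have X: "cinner (X x) (X y) = cinner x y - cinner (W x) (W y)" for x y
    by (simp add: X_def cinner_ell2_single ell2_single.rep_eq R)
  \<comment> \<open>\<open>Q = sum_i T_i Q T_i^*\<close> as a Gram identity: the defect terms in the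
    recursions for \<open>I\<close> and for \<open>W^* W\<close> cancel.\<close>
  have Xeq: "cinner (X x) (X y) = (\<Sum>i\<in>UNIV. cinner (X (adj (T i) x)) (X (adj (T i) y)))" for x y
    unfolding X sum_subtractf using cinner_poisson_kernel[OF T, of x y] cinner_defect_op[OF T, of x y]
    by (simp add: W_def)
  define K where "K = closure (range X)"
  have "\<exists>Z. (\<forall>i. Z i \<in> bounded_ops K K) \<and>
    (\<forall>x\<in>K. (\<Sum>i\<in>UNIV. Z i (adjoint_on K (Z i) x)) = x) \<and>
    (\<forall>i. \<forall>x\<in>K. \<forall>h. cinner (Z i x) (X h) = cinner x (X (adj (T i) h)))"
    unfolding K_def by (rule coisometric_row_exists[OF Xb adj_bounded_ops[OF Tb] Xeq])
  then obtain Z where Zb: "\<And>i. Z i \<in> bounded_ops K K"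
    and ZZ: "\<forall>x\<in>K. (\<Sum>i\<in>UNIV. Z i (adjoint_on K (Z i) x)) = x"
    and ZX: "\<forall>i. \<forall>x\<in>K. \<forall>h. cinner (Z i x) (X h) = cinner x (X (adj (T i) h))"
    by (elim exE conjE) blast
  have K: "csubspace K" "closed K" unfolding K_def by (auto intro: csubspace_closure csubspace_range[OF Xb])
  have XK: "X h \<in> K" for h unfolding K_def by (rule subsetD[OF closure_subset]) simp
  have poly: "ncpoly_op p Z x = 0" if p: "p \<in> P" and x: "x \<in> K" for p x
  proof -
    \<comment> \<open>A vector of \<open>K\<close> orthogonal to the dense range of \<open>X\<close>
      is orthogonal to itself, so membership in \<open>K\<close> and weak vanishing suffice.\<close>
    have "ncpoly_op p Z x \<in> K"
      unfolding ncpoly_op_def using x bounded_opsD(1)[OF word_op_bounded_ops[where T = Z and M = K, OF Zb]]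
      by (intro complex_vector.subspace_sum complex_vector.subspace_scale K) auto
    moreover have "cinner (ncpoly_op p Z x) (X h) = 0" for h
      by (rule cinner_ncpoly_op_eq_0[where T = T and M = K])
         (simp_all add: Tb ZX Xb bounded_opsD(1)[OF Zb] P p x)
    ultimately have "cinner (ncpoly_op p Z x) (ncpoly_op p Z x) = 0"
      unfolding K_def by (rule cinner_closure_range_eq_0[rotated])
    then show ?thesis by simp
  qed
  define N where "N = N_space J"
  define D where "D = closure (range (defect_op T))"
  define Kt where "Kt = hilbert_tensor N D \<times> K"
  define V where "V = (\<lambda>i. map_prod (ampliation N D (constrained_shift J i)) (Z i))"
  define \<Gamma> where "\<Gamma> h = (W h, X h)" for h
  have WE: "W h \<in> hilbert_tensor N D" for h
    unfolding W_def N_def D_def by (rule poisson_kernel_in_tensor(2)[OF T gen P])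
  have slice: "slice d (W h) \<in> N_space J" for d h
    unfolding W_def by (rule slice_poisson_kernel_in_N_space[OF T gen P])
  have Kt: "csubspace Kt"
    unfolding Kt_def using K(1) csubspace_hilbert_tensor[of N D]
    by (intro complex_vector.subspaceI)
       (auto simp: scaleC_prod_def zero_prod_def complex_vector.subspace_0 complex_vector.subspace_add
          complex_vector.subspace_scale)
  have \<Gamma>_Kt: "\<Gamma> h \<in> Kt" for h by (simp add: \<Gamma>_def Kt_def WE XK)
  have norm_\<Gamma>: "norm (\<Gamma> h) = norm h" for h
    unfolding norm_eq_sqrt_cinner \<Gamma>_def cinner_prod_def by (simp add: X)
  have \<Gamma>b: "\<Gamma> \<in> bounded_ops UNIV Kt"
    by (rule bounded_opsI[where C = 1])
       (simp_all add: \<Gamma>_Kt norm_\<Gamma>, simp_all add: \<Gamma>_def scaleC_prod_def bounded_opsD[OF Wb] bounded_opsD[OF Xb])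
  \<comment> \<open>The adjoint at \<open>\<Gamma> h\<close> is found by exhibiting a vector of
    \<open>Kt\<close> with its defining property. The two components are checked separately: the
    compressed shift against \<open>W h\<close>, and \<open>Z i\<close> against
    \<open>X h\<close>.\<close>
  have adj\<Gamma>: "adjoint_on Kt (V i) (\<Gamma> h) = \<Gamma> (adj (T i) h)" for i h
  proof (rule adjoint_on_eqI[OF Kt \<Gamma>_Kt])
    fix x assume "x \<in> Kt"
    then have "fst x \<in> hilbert_tensor N D" "snd x \<in> K" by (auto simp: Kt_def)
    moreover have "left_shift_adj i (W h) = W (adj (T i) h)"
      unfolding W_def by (rule left_shift_adj_poisson_kernel[OF T])
    ultimately show "cinner (V i x) (\<Gamma> h) = cinner x (\<Gamma> (adj (T i) h))"
      using cinner_ampliation_constrained_shift[of "fst x" J D "W h" i] slice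
      by (simp add: V_def \<Gamma>_def cinner_prod_def ZX N_def)
  qed
  have "co_invariant Kt (range V) (range \<Gamma>)"
    unfolding co_invariant_def using \<Gamma>_Kt
    by (auto simp: adj\<Gamma> intro: csubspace_range[OF \<Gamma>b] closed_range_isometry[OF \<Gamma>b norm_\<Gamma>])
  then have dilation: "\<exists>\<Gamma>. \<Gamma> \<in> bounded_ops UNIV Kt \<and> (\<forall>h. norm (\<Gamma> h) = norm h) \<and>
      co_invariant Kt (range V) (range \<Gamma>) \<and> (\<forall>i h. \<Gamma> (adj (T i) h) = adjoint_on Kt (V i) (\<Gamma> h))"
    using \<Gamma>b norm_\<Gamma> adj\<Gamma> by (intro exI[of _ \<Gamma>]) simp
  have normX: "(norm (X h))\<^sup>2 = (norm h)\<^sup>2 - (norm (W h))\<^sup>2" for h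
    by (simp add: norm_square_eq_cinner X)
  have "K = {0} \<longleftrightarrow> (\<forall>h. X h = 0)"
  proof
    assume "\<forall>h. X h = 0"
    then have "range X = {0}" by auto
    then show "K = {0}" by (simp add: K_def)
  qed (use XK in auto)
  also have "\<dots> \<longleftrightarrow> (\<forall>h. (norm (X h))\<^sup>2 = 0)" by simp
  also have "\<dots> \<longleftrightarrow> (\<forall>h. norm (W h) = norm h)"
    unfolding normX by (metis diff_eq_eq add_0 norm_ge_zero power2_eq_iff_nonneg)
  also have "\<dots> \<longleftrightarrow> pure_row_contraction T"
    unfolding W_def by (rule pure_iff_poisson_kernel_isometric[OF T, symmetric])
  finally have pure: "K = {0} \<longleftrightarrow> pure_row_contraction T" .
  show ?thesis
    using K Zb ZZ poly dilation pure
    unfolding Let_def N_def[symmetric] D_def[symmetric] Kt_def[symmetric] V_def[symmetric]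
    by (intro exI[of _ K] exI[of _ Z]) (simp add: Kt_def V_def)
qed

end
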